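(* For each integer $\ell \geqslant 2$ and each $\delta > 0$, there exists a constant $C = C(\delta,\ell)$ such that the following holds for every sufficiently large $n \in \mathbb{N}$. There exists a collection $\mathcal{G}$ of at most $2^{\delta n^{1+1/\ell}}$ graphs on vertex set $[n]$ such that $e(G) \leqslant C n^{1+1/\ell}$ for every $G \in \mathcal{G}$, and every $C_{2\ell}$-free graph on vertex set $[n]$ is a subgraph of some $G \in \mathcal{G}$.
   Context: $C_{2\ell}$ denotes the cycle of length $2\ell$; $e(G)$ is the number of edges of $G$. *)

theory Defs
  imports Complex_Main
begin

type_synonym 'a ugraph = "'a set \<times> 'a set set"

abbreviation uverts :: "'a ugraph \<Rightarrow> 'a set" where
  "uverts G \<equiv> fst G"

abbreviation uedges :: "'a ugraph \<Rightarrow> 'a set set" where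
  "uedges G \<equiv> snd G"

definition simple_graph :: "'a ugraph \<Rightarrow> bool" where
  "simple_graph G \<longleftrightarrow> (\<forall>e \<in> uedges G. e \<subseteq> uverts G \<and> card e = 2)"

text \<open>Labelled graphs: isomorphic but distinct graphs count as different elements.\<close>

definition graphs_on :: "'a set \<Rightarrow> 'a ugraph set" where
  "graphs_on V = {G. simple_graph G \<and> uverts G = V}"

definition subgraph_of :: "'a ugraph \<Rightarrow> 'a ugraph \<Rightarrow> bool" where
  "subgraph_of H G \<longleftrightarrow> uverts H \<subseteq> uverts G \<and> uedges H \<subseteq> uedges G"

definition graph_iso :: "'a ugraph \<Rightarrow> 'b ugraph \<Rightarrow> bool" where
  "graph_iso H G \<longleftrightarrow>
     (\<exists>f. bij_betw f (uverts H) (uverts G) \<and> uedges G = (\<lambda>e. f ` e) ` uedges H)"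

text \<open>Copies of \<open>H\<close> in \<open>G\<close> need not be induced.\<close>

definition free_of :: "'b ugraph \<Rightarrow> 'a ugraph \<Rightarrow> bool" where
  "free_of H G \<longleftrightarrow> \<not> (\<exists>K. simple_graph K \<and> subgraph_of K G \<and> graph_iso H K)"

text \<open>This is the cycle of length \<open>k\<close> only for \<open>k \<ge> 3\<close>.\<close>

definition cycle_graph :: "nat \<Rightarrow> nat ugraph" where
  "cycle_graph k = ({0..<k}, {{i, (i + 1) mod k} | i. i < k})"

end

theory Submission
  imports Defs
begin

text \<open>The proof combines three ingredients. (1) Bondy and Simonovits: a graph without a cycle of length
  \<open>2 l\<close> has \<open>O(n powr (1 + 1/l))\<close> edges; two consecutive layers of a breadth-first search tree span few
  edges, so large degrees force the layers to grow. (2) Balanced supersaturation, after Ferber, McKinley and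
  Samotij: if \<open>E\<close> has \<open>K n powr (1 + 1/l)\<close> edges, then a maximal family of cycles subject to the degree bounds
  \<open>2 * (1/\<tau>) ^ (2 l - |T|)\<close> is large, since otherwise (1), applied to a random induced subgraph, yields
  another cycle. Here \<open>\<tau>\<close> has order \<open>K powr (- 2 l / (2 l - 1))\<close>. (3) A hypergraph container argument turns
  this family into \<open>exp (O(\<tau> ln (1/\<tau>) |E|))\<close> sets, each missing a fixed proportion of \<open>E\<close>, that
  cover all cycle-free subsets. The exponent is \<open>O(K powr - \<eta>) * n powr (1 + 1/l)\<close> with \<open>\<eta> > 0\<close>, so
  iterating from the complete graph down to \<open>K = C\<close> gives a geometric sum, which is below \<open>\<delta>\<close> for large \<open>C\<close>.\<close>

section \<open>Hypergraph containers\<close>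

text \<open>Containers and cycle families fit together by scaling. The container argument wants
  degrees at most \<open>\<tau> ^ (card T - 1)\<close>; about
  \<open>card E * (1 / \<tau>) ^ (2 * l - 1)\<close> cycles with degrees of order
  \<open>(1 / \<tau>) ^ (2 * l - card T)\<close> achieve this after multiplication by
  \<open>\<tau> ^ (2 * l - 1)\<close>, and their total weight keeps the order of
  \<open>card E\<close>. The obstacle lies in the sampling. A proper nonempty set of j edges of a
  cycle spans at least j + 1 vertices, so it survives with probability at most
  \<open>p ^ (j + 1)\<close>, which \<open>p \<le> \<tau>\<close> controls. The complete cycle spans
  only as many vertices as it has edges and requires
  \<open>p ^ (2 * l - 2) \<le> \<tau> ^ (2 * l - 1)\<close>. The extremal bound fixes
  \<open>p\<close>, and this condition then determines \<open>\<tau>\<close>. As a result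
  \<open>\<tau> * card E\<close> has order K to the power - 1 / (2 l - 1), times
  \<open>n powr (1 + 1 / l)\<close>; half of that negative power of K pays for
  \<open>ln (1 / \<tau>)\<close> and the other half is the decay with exponent \<eta>.\<close>

definition weight_on :: "'a set \<Rightarrow> nat \<Rightarrow> ('a set \<Rightarrow> real) \<Rightarrow> bool" where
  "weight_on V r w \<longleftrightarrow> (\<forall>e. 0 \<le> w e \<and> (w e \<noteq> 0 \<longrightarrow> e \<subseteq> V \<and> card e = r))"

text \<open>The case \<open>T = {}\<close> gives the total weight; replacing \<open>V\<close> by a
  subset \<open>A\<close> restricts to the edges inside \<open>A\<close>.\<close>

definition wdeg :: "'a set \<Rightarrow> ('a set \<Rightarrow> real) \<Rightarrow> 'a set \<Rightarrow> real" where
  "wdeg V w T = (\<Sum>e | e \<subseteq> V \<and> T \<subseteq> e. w e)"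

text \<open>An edge of the hypergraph is a set of nonzero weight.\<close>

definition independent_set :: "('a set \<Rightarrow> real) \<Rightarrow> 'a set \<Rightarrow> bool" where
  "independent_set w I \<longleftrightarrow> (\<forall>e\<subseteq>I. w e = 0)"

lemma sum_cover_le:
  fixes f :: "'b \<Rightarrow> real"
  assumes "finite I" "\<And>i. i \<in> I \<Longrightarrow> finite (S i)" "U \<subseteq> (\<Union>i\<in>I. S i)" "\<And>x. 0 \<le> f x"
  shows "sum f U \<le> (\<Sum>i\<in>I. sum f (S i))"
  using assms
proof (induction I arbitrary: U rule: finite_induct)
  case empty
  then show ?case by simp
next
  case (insert i I)
  have fU: "finite U" using insert.hyps insert.prems(1,2) by (auto intro: finite_subset)
  have "sum f U = sum f (U \<inter> S i) + sum f (U - S i)"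
    using fU by (metis sum.Int_Diff)
  also have "\<dots> \<le> sum f (S i) + (\<Sum>i\<in>I. sum f (S i))"
    using insert by (intro add_mono sum_mono2 insert.IH) auto
  finally show ?case using insert by simp
qed

lemma weight_on_nonneg: "weight_on V r w \<Longrightarrow> 0 \<le> w e"
  by (simp add: weight_on_def)

lemma weight_on_supp: "weight_on V r w \<Longrightarrow> w e \<noteq> 0 \<Longrightarrow> e \<subseteq> V \<and> card e = r"
  by (simp add: weight_on_def)

lemma wdeg_outside: "\<not> T \<subseteq> V \<Longrightarrow> wdeg V w T = 0"
  unfolding wdeg_def by (intro sum.neutral) auto

text \<open>Each lost edge contains a removed vertex, and one vertex carries weight at most 1. The
  decision tree uses this to turn lost weight into discarded vertices.\<close>

lemma wdeg_remove_vertices: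
  assumes fin: "finite V" and w: "weight_on V r w" and "A \<subseteq> V"
    and deg: "\<And>v. wdeg V w {v} \<le> 1"
  shows "wdeg V w {} - wdeg A w {} \<le> real (card (V - A))"
proof -
  have "wdeg V w {} - wdeg A w {} = (\<Sum>e\<in>Pow V - Pow A. w e)"
    using fin \<open>A \<subseteq> V\<close> unfolding wdeg_def
    by (subst sum_diff) (auto simp: Pow_def)
  also have "\<dots> \<le> (\<Sum>v\<in>V - A. \<Sum>e | e \<subseteq> V \<and> {v} \<subseteq> e. w e)"
    using fin weight_on_nonneg[OF w] by (intro sum_cover_le) auto
  also have "\<dots> \<le> (\<Sum>v\<in>V - A. 1)"
    using deg unfolding wdeg_def by (intro sum_mono) auto
  finally show ?thesis by simp
qed

text \<open>An edge of \<open>g\<close> has \<open>r\<close> elements, so it is counted at most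
  \<open>2 ^ r\<close> times.\<close>

lemma sum_wdeg_le:
  assumes fin: "finite V" and g: "weight_on V r g" and "\<S> \<subseteq> Pow V"
  shows "(\<Sum>T\<in>\<S>. wdeg V g T) \<le> 2 ^ r * wdeg V g {}"
proof -
  have fS: "finite \<S>" using fin assms(3) finite_subset by blast
  have "(\<Sum>T\<in>\<S>. wdeg V g T) = (\<Sum>T\<in>\<S>. \<Sum>e\<in>Pow V. if T \<subseteq> e then g e else 0)"
    using fin by (simp add: wdeg_def Pow_def flip: sum.inter_filter)
  also have "\<dots> = (\<Sum>e\<in>Pow V. \<Sum>T\<in>\<S>. if T \<subseteq> e then g e else 0)"
    by (rule sum.swap)
  also have "\<dots> \<le> (\<Sum>e\<in>Pow V. 2 ^ r * g e)"
  proof (rule sum_mono)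
    fix e assume e: "e \<in> Pow V"
    have "(\<Sum>T\<in>\<S>. if T \<subseteq> e then g e else 0) = real (card (\<S> \<inter> {T. T \<subseteq> e})) * g e"
      using fS by (simp add: sum.If_cases)
    also have "\<dots> \<le> real (card (Pow e)) * g e"
      using e fin weight_on_nonneg[OF g] 
      by (intro mult_right_mono) (auto intro!: card_mono intro: finite_subset)
    also have "\<dots> = 2 ^ r * g e"
      using weight_on_supp[OF g, of e] e fin 
      by (cases "g e = 0") (auto intro!: card_Pow intro: finite_subset)
    finally show "(\<Sum>T\<in>\<S>. if T \<subseteq> e then g e else 0) \<le> 2 ^ r * g e" .
  qed
  also have "\<dots> = 2 ^ r * wdeg V g {}"
    by (simp add: wdeg_def sum_distrib_left Pow_def)
  finally show ?thesis .
qed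

text \<open>A set \<open>T\<close> is saturated once its degree in \<open>g\<close> exceeds \<open>\<tau> ^ card T\<close>. By double counting, light
  \<open>g\<close> has so few saturated sets that they meet little of the weight of \<open>w\<close>; so some vertex \<open>v\<close> has a link
  of weight at least \<open>\<beta> / 4\<close> that contains no saturated set, and adding this link to \<open>g\<close> at most doubles
  the degree bound.\<close>

lemma link_step:
  fixes \<beta> \<tau> :: real
  assumes fin: "finite V" and tau: "0 < \<tau>" and beta: "0 < \<beta>"
    and w: "weight_on V (Suc r) w" and wb: "\<And>T. T \<noteq> {} \<Longrightarrow> wdeg V w T \<le> \<tau> ^ (card T - 1)"
    and A: "A \<subseteq> V" and wA: "\<beta> / 2 * card V \<le> wdeg A w {}" and "V \<noteq> {}"
    and g: "weight_on V r g" and gb: "\<And>T. T \<noteq> {} \<Longrightarrow> wdeg V g T \<le> 2 * \<tau> ^ card T"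
    and gt: "wdeg V g {} \<le> \<beta> / 2 ^ (r + 2) * \<tau> * card V"
  shows "\<exists>v\<in>A. \<exists>g'. weight_on V r g' \<and> (\<forall>T. T \<noteq> {} \<longrightarrow> wdeg V g' T \<le> 2 * \<tau> ^ card T) \<and>
    wdeg V g {} + \<beta> / 4 \<le> wdeg V g' {} \<and>
    (\<forall>I. v \<in> I \<longrightarrow> independent_set w I \<longrightarrow> independent_set g I \<longrightarrow> independent_set g' I)"
proof -
  note w0 = weight_on_nonneg[OF w] and g0 = weight_on_nonneg[OF g]
  define Sat where "Sat = {T. T \<subseteq> V \<and> T \<noteq> {} \<and> wdeg V g T > \<tau> ^ card T}"
  define U where "U = {e. e \<subseteq> A \<and> (\<forall>T\<in>Sat. \<not> T \<subseteq> e)}"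
  have finA: "finite A" using fin A finite_subset by blast
  have finSat: "finite Sat" using fin unfolding Sat_def by auto
  have finU: "finite U" using finA unfolding U_def by auto
  have "(\<Sum>e\<in>Pow A - U. w e) \<le> (\<Sum>T\<in>Sat. wdeg V w T)"
    unfolding wdeg_def using fin A finSat w0 by (intro sum_cover_le) (auto simp: U_def)
  \<comment> \<open>Saturation converts degrees in \<open>w\<close> into degrees in
    \<open>g\<close>: \<open>wb\<close> allows at most \<open>\<tau> ^ card T / \<tau>\<close>,
    which is less than \<open>wdeg V g T / \<tau>\<close>.\<close>
  also have "\<dots> \<le> (\<Sum>T\<in>Sat. wdeg V g T / \<tau>)"
  proof (rule sum_mono)
    fix T assume T: "T \<in> Sat"
    then have "T \<noteq> {}" "finite T" using fin finite_subset by (auto simp: Sat_def)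
    then have "card T = Suc (card T - 1)" by (simp add: card_gt_0_iff)
    then have "\<tau> ^ (card T - 1) = \<tau> ^ card T / \<tau>" using tau
      by (metis nonzero_mult_div_cancel_left order_less_irrefl power_Suc)
    also have "\<dots> \<le> wdeg V g T / \<tau>" using T tau by (intro divide_right_mono) (auto simp: Sat_def)
    finally show "wdeg V w T \<le> wdeg V g T / \<tau>" using wb[OF \<open>T \<noteq> {}\<close>] by linarith
  qed
  also have "\<dots> = (\<Sum>T\<in>Sat. wdeg V g T) / \<tau>" by (simp add: sum_divide_distrib)
  also have "\<dots> \<le> 2 ^ r * wdeg V g {} / \<tau>"
    using tau by (intro divide_right_mono sum_wdeg_le[OF fin g]) (auto simp: Sat_def)
  \<comment> \<open>The factor \<open>2 ^ (r + 2)\<close> in \<open>gt\<close> originates here: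
    edges over saturated sets use up at most half of the weight that \<open>wA\<close> guarantees in
    \<open>A\<close>.\<close>
  also have "\<dots> \<le> 2 ^ r * (\<beta> / 2 ^ (r + 2) * \<tau> * card V) / \<tau>"
    using tau gt by (intro divide_right_mono mult_left_mono) auto
  also have "\<dots> = \<beta> / 4 * card V" using tau by (simp add: power_add)
  finally have "(\<Sum>e\<in>Pow A - U. w e) \<le> \<beta> / 4 * card V" .
  moreover have "wdeg A w {} = (\<Sum>e\<in>Pow A. w e)" by (simp add: wdeg_def Pow_def)
  moreover have "(\<Sum>e\<in>Pow A. w e) = (\<Sum>e\<in>Pow A - U. w e) + (\<Sum>e\<in>U. w e)"
    using finA by (intro sum.subset_diff) (auto simp: U_def)
  ultimately have U_large: "\<beta> / 4 * card V \<le> (\<Sum>e\<in>U. w e)" using wA by linarith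
  have "\<exists>v\<in>A. \<beta> / 4 \<le> (\<Sum>e | e \<in> U \<and> v \<in> e. w e)"
  proof (rule ccontr)
    assume "\<not> ?thesis"
    then have small: "\<And>v. v \<in> A \<Longrightarrow> (\<Sum>e | e \<in> U \<and> v \<in> e. w e) < \<beta> / 4" by force
    have posV: "0 < \<beta> / 4 * card V" using beta fin \<open>V \<noteq> {}\<close> by (simp add: card_gt_0_iff)
    have "A \<noteq> {}"
    proof
      assume "A = {}"
      then have "wdeg A w {} = w {}" by (simp add: wdeg_def)
      then have "w {} \<noteq> 0" using wA posV by linarith
      then show False using weight_on_supp[OF w, of "{}"] by simp
    qed
    have "(\<Sum>e\<in>U. w e) = (\<Sum>e\<in>U - {{}}. w e)"
      using finU weight_on_supp[OF w, of "{}"] by (intro sum.mono_neutral_right) auto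
    also have "\<dots> \<le> (\<Sum>v\<in>A. \<Sum>e | e \<in> U \<and> v \<in> e. w e)"
      using finA finU w0 by (intro sum_cover_le) (auto simp: U_def)
    also have "\<dots> < (\<Sum>v\<in>A. \<beta> / 4)"
      using small finA \<open>A \<noteq> {}\<close> by (intro sum_strict_mono) auto
    also have "\<dots> \<le> \<beta> / 4 * card V" using beta card_mono[OF fin A] by (simp add: mult.commute mult_left_mono)
    finally show False using U_large by linarith
  qed
  then obtain v where v: "v \<in> A" and vdeg: "\<beta> / 4 \<le> (\<Sum>e | e \<in> U \<and> v \<in> e. w e)" by blast
  \<comment> \<open>The link of \<open>v\<close>, restricted to edges of \<open>U\<close>. If
    \<open>v \<in> I\<close>, an edge of this link inside \<open>I\<close> would complete to an edge
    of \<open>w\<close> inside \<open>I\<close>; hence independence passes to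
    \<open>g'\<close>.\<close>
  define h where "h = (\<lambda>f. if v \<notin> f \<and> insert v f \<in> U then w (insert v f) else 0)"
  define g' where "g' = (\<lambda>f. g f + h f)"
  have h0: "0 \<le> h f" for f using w0 by (simp add: h_def)
  have hsupp: "f \<subseteq> V \<and> card f = r" if "h f \<noteq> 0" for f
  proof -
    from that have "v \<notin> f" "insert v f \<in> U" "w (insert v f) \<noteq> 0"
      by (auto simp: h_def split: if_splits)
    with weight_on_supp[OF w, of "insert v f"] fin show ?thesis
      by (metis card_insert_disjoint finite_insert finite_subset insert_subset nat.inject)
  qed
  have wdeg_h: "wdeg V h T = (\<Sum>e | e \<in> U \<and> insert v T \<subseteq> e. w e)" if "v \<notin> T" for T
  proof -
    have "wdeg V h T = (\<Sum>f\<in>{f. f \<subseteq> V \<and> T \<subseteq> f \<and> v \<notin> f \<and> insert v f \<in> U}. h f)"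
      unfolding wdeg_def using fin by (intro sum.mono_neutral_right) (auto simp: h_def)
    also have "\<dots> = (\<Sum>e\<in>{e. e \<in> U \<and> insert v T \<subseteq> e}. w e)"
      by (rule sum.reindex_bij_witness[of _ "\<lambda>e. e - {v}" "insert v"])
         (use A that in \<open>auto simp: h_def U_def insert_absorb\<close>)
    finally show ?thesis by simp
  qed
  have wdeg_g': "wdeg V g' T = wdeg V g T + wdeg V h T" for T
    by (simp add: wdeg_def g'_def sum.distrib)
  show ?thesis
  proof (intro bexI[OF _ v] exI[of _ g'] conjI allI impI)
    show "weight_on V r g'"
      using hsupp weight_on_supp[OF g] g0 h0
      unfolding weight_on_def g'_def by (metis add_nonneg_nonneg add.right_neutral)
    show "wdeg V g' T \<le> 2 * \<tau> ^ card T" if "T \<noteq> {}" for T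
    proof (cases "wdeg V h T = 0")
      case True
      then show ?thesis using gb[OF that] wdeg_g' by simp
    next
      case False
      have "v \<notin> T"
      proof
        assume "v \<in> T"
        then have "wdeg V h T = 0" unfolding wdeg_def by (intro sum.neutral) (auto simp: h_def)
        with False show False ..
      qed
      have ne: "(\<Sum>e | e \<in> U \<and> insert v T \<subseteq> e. w e) \<noteq> 0" using False wdeg_h[OF \<open>v \<notin> T\<close>] by simp
      \<comment> \<open>Only subsets of edges in \<open>U\<close> gain degree, and these are not
        saturated; so the old and the new degree each contribute at most
        \<open>\<tau> ^ card T\<close>.\<close>
      then obtain e where e: "e \<in> U" "insert v T \<subseteq> e"
        by (rule sum.not_neutral_contains_not_neutral) blast
      then have "T \<notin> Sat" "T \<subseteq> V" using A by (auto simp: U_def)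
      then have "wdeg V g T \<le> \<tau> ^ card T" using that by (auto simp: Sat_def)
      moreover have "wdeg V h T \<le> wdeg V w (insert v T)"
        unfolding wdeg_h[OF \<open>v \<notin> T\<close>] unfolding wdeg_def
        using fin A w0 by (intro sum_mono2) (auto simp: U_def)
      moreover have "wdeg V w (insert v T) \<le> \<tau> ^ card T"
        using wb[of "insert v T"] \<open>v \<notin> T\<close> \<open>T \<subseteq> V\<close> fin finite_subset by fastforce
      ultimately show ?thesis using wdeg_g' by simp
    qed
    show "wdeg V g {} + \<beta> / 4 \<le> wdeg V g' {}"
      using vdeg wdeg_g'[of "{}"] wdeg_h[of "{}"] by simp
    show "independent_set g' I" if "v \<in> I" "independent_set w I" "independent_set g I" for I
      using that by (auto simp: independent_set_def g'_def h_def)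
  qed
qed

text \<open>The containers are the leaves of a binary decision tree. \<open>S\<close> consists of the queried vertices that lie
  in the independent set \<open>I\<close>, and \<open>A\<close> of the vertices not yet queried. The answer \<open>v \<notin> I\<close> keeps the
  exponent of \<open>1 / \<tau>\<close>, the answer \<open>v \<in> I\<close> lowers it by one, and both remove a factor \<open>1 + \<tau>\<close>; this is the
  recursion of the bound on the number of leaves.\<close>

lemma container_tree:
  fixes \<beta> \<tau> c Bd :: real
  assumes fin: "finite V" and tau: "0 < \<tau>" "\<tau> \<le> \<beta> / 4" "\<tau> \<le> 1" and beta: "0 < \<beta>" and "V \<noteq> {}"
    and w: "weight_on V (Suc r) w" and wb: "\<And>T. T \<noteq> {} \<Longrightarrow> wdeg V w T \<le> \<tau> ^ (card T - 1)"
    and tot: "\<beta> * card V \<le> wdeg V w {}" and Bd: "1 \<le> Bd" and c: "c \<le> \<beta> / 4"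
    and IH: "\<And>g. weight_on V r g \<Longrightarrow> (\<And>T. T \<noteq> {} \<Longrightarrow> wdeg V g T \<le> 2 * \<tau> ^ card T) \<Longrightarrow>
      \<beta> / 2 ^ (r + 2) * \<tau> * card V \<le> wdeg V g {} \<Longrightarrow>
      \<exists>\<C>. finite \<C> \<and> real (card \<C>) \<le> Bd \<and> (\<forall>C\<in>\<C>. C \<subseteq> V \<and> card C \<le> (1 - c) * card V) \<and>
          (\<forall>I\<subseteq>V. independent_set g I \<longrightarrow> (\<exists>C\<in>\<C>. I \<subseteq> C))"
  shows "A \<subseteq> V \<Longrightarrow> S \<subseteq> V \<Longrightarrow> A \<inter> S = {} \<Longrightarrow> weight_on V r g \<Longrightarrow>
    (\<And>T. T \<noteq> {} \<Longrightarrow> wdeg V g T \<le> 2 * \<tau> ^ card T) \<Longrightarrow>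
    \<beta> / 4 * card S \<le> wdeg V g {} \<Longrightarrow> real (card S) \<le> \<tau> * card V + 1 \<Longrightarrow>
    \<exists>\<C>. finite \<C> \<and>
      real (card \<C>) \<le> (1 + \<tau>) ^ card A * (1 / \<tau>) powr (\<tau> * card V + 1 - card S) * Bd \<and>
      (\<forall>C\<in>\<C>. C \<subseteq> V \<and> card C \<le> (1 - c) * card V) \<and>
      (\<forall>I. S \<subseteq> I \<longrightarrow> I \<subseteq> A \<union> S \<longrightarrow> independent_set w I \<longrightarrow> independent_set g I \<longrightarrow> (\<exists>C\<in>\<C>. I \<subseteq> C))"
proof (induction "card A" arbitrary: A S g rule: less_induct)
  case less
  note AV = less.prems(1) and SV = less.prems(2) and AS = less.prems(3) and g = less.prems(4)
    and gb = less.prems(5) and gS = less.prems(6) and Sq = less.prems(7)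
  define cost where "cost = (\<lambda>(a::nat) (s::nat). (1 + \<tau>) ^ a * (1 / \<tau>) powr (\<tau> * card V + 1 - s) * Bd)"
  have finA: "finite A" and finS: "finite S" using fin AV SV finite_subset by blast+
  \<comment> \<open>The exponent stays nonnegative because \<open>S\<close> exceeds
    \<open>\<tau> * card V\<close> by at most 1: a vertex joins \<open>S\<close> only while
    \<open>g\<close> is light, and then \<open>S_small\<close> holds.\<close>
  have cost_ge: "Bd \<le> cost (card A) (card S)"
  proof -
    have "1 \<le> (1 + \<tau>) ^ card A" using tau by (simp add: one_le_power)
    moreover have "1 \<le> (1 / \<tau>) powr (\<tau> * card V + 1 - card S)"
      using tau Sq by (intro ge_one_powr_ge_zero) auto
    ultimately have "1 * 1 * Bd \<le> cost (card A) (card S)"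
      unfolding cost_def using Bd by (intro mult_mono) auto
    then show ?thesis by simp
  qed
  have cost_fold: "(1 + \<tau>) ^ card A * (1 / \<tau>) powr (\<tau> * card V + 1 - card S) * Bd = cost (card A) (card S)"
    by (simp add: cost_def)
  show ?case unfolding cost_fold
  proof (cases "\<beta> / 2 ^ (r + 2) * \<tau> * card V \<le> wdeg V g {}")
    \<comment> \<open>Once \<open>g\<close> is heavy, the containers for the
      \<open>r\<close>-uniform weight \<open>g\<close> finish this branch.\<close>
    case True
    from IH[OF g gb True] obtain \<C> where C: "finite \<C>" "real (card \<C>) \<le> Bd"
        "\<forall>C\<in>\<C>. C \<subseteq> V \<and> card C \<le> (1 - c) * card V"
        "\<forall>I\<subseteq>V. independent_set g I \<longrightarrow> (\<exists>C\<in>\<C>. I \<subseteq> C)" by blast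
    have "real (card \<C>) \<le> cost (card A) (card S)" using C(2) cost_ge by linarith
    moreover have "I \<subseteq> V" if "I \<subseteq> A \<union> S" for I using that AV SV by blast
    ultimately show "\<exists>\<C>. finite \<C> \<and> real (card \<C>) \<le> cost (card A) (card S) \<and>
      (\<forall>C\<in>\<C>. C \<subseteq> V \<and> card C \<le> (1 - c) * card V) \<and>
      (\<forall>I. S \<subseteq> I \<longrightarrow> I \<subseteq> A \<union> S \<longrightarrow> independent_set w I \<longrightarrow> independent_set g I \<longrightarrow> (\<exists>C\<in>\<C>. I \<subseteq> C))"
      using C(1,3,4) by (intro exI[of _ \<C>]) auto
  next
    case False
    \<comment> \<open>Each vertex of \<open>S\<close> has brought weight at least
      \<open>\<beta> / 4\<close> into \<open>g\<close>, so a light \<open>g\<close> forces a small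
      \<open>S\<close>.\<close>
    have S_small: "real (card S) \<le> \<tau> * card V"
    proof -
      have "\<beta> / 4 * card S \<le> \<beta> / 2 ^ (r + 2) * \<tau> * card V" using False gS by linarith
      also have "\<dots> = (\<beta> / 4 * (\<tau> * card V)) / 2 ^ r" by (simp add: power_add)
      also have "\<dots> \<le> (\<beta> / 4 * (\<tau> * card V)) / 1"
        using beta tau by (intro divide_left_mono) auto
      finally show ?thesis using beta by simp
    qed
    show "\<exists>\<C>. finite \<C> \<and> real (card \<C>) \<le> cost (card A) (card S) \<and>
      (\<forall>C\<in>\<C>. C \<subseteq> V \<and> card C \<le> (1 - c) * card V) \<and>
      (\<forall>I. S \<subseteq> I \<longrightarrow> I \<subseteq> A \<union> S \<longrightarrow> independent_set w I \<longrightarrow> independent_set g I \<longrightarrow> (\<exists>C\<in>\<C>. I \<subseteq> C))"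
    proof (cases "\<beta> / 2 * card V \<le> wdeg A w {}")
      \<comment> \<open>So much weight has left \<open>A\<close> that a proportion
        \<open>\<beta> / 2\<close> of the vertices lies outside \<open>A\<close>. As
        \<open>S\<close> gives back at most a proportion \<open>\<tau> \<le> \<beta> / 4\<close>,
        the set \<open>A \<union> S\<close> is itself a container.\<close>
      case False
      have w1: "wdeg V w {v} \<le> 1" for v using wb[of "{v}"] by simp
      have "wdeg V w {} - wdeg A w {} \<le> real (card (V - A))"
        by (rule wdeg_remove_vertices[OF fin w AV w1])
      also have "\<dots> = card V - real (card A)"
        using card_mono[OF fin AV] AV finA by (simp add: card_Diff_subset of_nat_diff)
      finally have "card A \<le> (1 - \<beta> / 2) * card V" using tot False by (simp add: algebra_simps)
      moreover have "\<tau> * card V \<le> \<beta> / 4 * card V" using tau by (intro mult_right_mono) auto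
      moreover have "c * card V \<le> \<beta> / 4 * card V" using c by (intro mult_right_mono) auto
      moreover have "card (A \<union> S) = card A + card S" using finA finS AS by (rule card_Un_disjoint)
      ultimately have "card (A \<union> S) \<le> (1 - c) * card V" using S_small by (simp add: algebra_simps)
      then show ?thesis using AV SV cost_ge Bd by (intro exI[of _ "{A \<union> S}"]) auto
    next
      case True
      obtain v g' where v: "v \<in> A" and g': "weight_on V r g'"
        "\<And>T. T \<noteq> {} \<Longrightarrow> wdeg V g' T \<le> 2 * \<tau> ^ card T"
        "wdeg V g {} + \<beta> / 4 \<le> wdeg V g' {}"
        "\<And>I. v \<in> I \<Longrightarrow> independent_set w I \<Longrightarrow> independent_set g I \<Longrightarrow> independent_set g' I"
      proof -
        have "wdeg V g {} \<le> \<beta> / 2 ^ (r + 2) * \<tau> * card V"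
          using \<open>\<not> \<beta> / 2 ^ (r + 2) * \<tau> * card V \<le> wdeg V g {}\<close> by linarith
        from link_step[OF fin tau(1) beta w wb AV True \<open>V \<noteq> {}\<close> g gb this] that
        show thesis by blast
      qed
      define A' where "A' = A - {v}"
      have A': "A' \<subseteq> V" "A' \<inter> S = {}" "A' \<inter> insert v S = {}" "card A = Suc (card A')"
        using AV AS v finA card_Suc_Diff1[OF finA v] by (auto simp: A'_def)
      have vS: "card (insert v S) = Suc (card S)"
        using v AS finS by (metis IntI card_insert_disjoint empty_iff)
      have "\<exists>\<C>. finite \<C> \<and> real (card \<C>) \<le> cost (card A') (card S) \<and>
        (\<forall>C\<in>\<C>. C \<subseteq> V \<and> card C \<le> (1 - c) * card V) \<and>
        (\<forall>I. S \<subseteq> I \<longrightarrow> I \<subseteq> A' \<union> S \<longrightarrow> independent_set w I \<longrightarrow> independent_set g I \<longrightarrow> (\<exists>C\<in>\<C>. I \<subseteq> C))"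
        unfolding cost_def 
      proof (rule less.hyps)
        show "card A' < card A" using A'(4) by simp
      qed (rule A'(1,2) SV g gS Sq | erule gb)+
      then obtain \<C>1 where C1: "finite \<C>1" "real (card \<C>1) \<le> cost (card A') (card S)"
        "\<forall>C\<in>\<C>1. C \<subseteq> V \<and> card C \<le> (1 - c) * card V"
        "\<And>I. S \<subseteq> I \<Longrightarrow> I \<subseteq> A' \<union> S \<Longrightarrow> independent_set w I \<Longrightarrow> independent_set g I \<Longrightarrow> \<exists>C\<in>\<C>1. I \<subseteq> C"
        by blast
      have "\<exists>\<C>. finite \<C> \<and> real (card \<C>) \<le> cost (card A') (card (insert v S)) \<and>
        (\<forall>C\<in>\<C>. C \<subseteq> V \<and> card C \<le> (1 - c) * card V) \<and>
        (\<forall>I. insert v S \<subseteq> I \<longrightarrow> I \<subseteq> A' \<union> insert v S \<longrightarrow> independent_set w I \<longrightarrow> independent_set g' I \<longrightarrow> (\<exists>C\<in>\<C>. I \<subseteq> C))"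
        unfolding cost_def 
      proof (rule less.hyps)
        show "\<beta> / 4 * card (insert v S) \<le> wdeg V g' {}"
          using g'(3) gS vS by (simp add: algebra_simps)
        show "real (card (insert v S)) \<le> \<tau> * card V + 1" using S_small vS by simp
      
        show "card A' < card A" using A'(4) by simp
        show "insert v S \<subseteq> V" using v AV SV by blast
      qed (rule A'(1,3) g'(1) | erule g'(2))+
      then obtain \<C>2 where C2: "finite \<C>2" "real (card \<C>2) \<le> cost (card A') (Suc (card S))"
        "\<forall>C\<in>\<C>2. C \<subseteq> V \<and> card C \<le> (1 - c) * card V"
        "\<And>I. insert v S \<subseteq> I \<Longrightarrow> I \<subseteq> A' \<union> insert v S \<Longrightarrow> independent_set w I \<Longrightarrow> independent_set g' I \<Longrightarrow> \<exists>C\<in>\<C>2. I \<subseteq> C"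
        unfolding vS by blast
      have "(1 / \<tau>) powr (\<tau> * card V + 1 - Suc (card S)) = (1 / \<tau>) powr (\<tau> * card V + 1 - card S) * \<tau>"
      proof -
        have "(1 / \<tau>) powr (\<tau> * card V + 1 - Suc (card S)) = (1 / \<tau>) powr ((\<tau> * card V + 1 - card S) - 1)"
          by (simp add: algebra_simps)
        also have "\<dots> = (1 / \<tau>) powr (\<tau> * card V + 1 - card S) * \<tau>"
          using tau by (simp only: powr_diff) simp
        finally show ?thesis .
      qed
      then have "cost (card A') (card S) + cost (card A') (Suc (card S)) = cost (card A) (card S)"
        by (simp add: cost_def A'(4) algebra_simps)
      moreover have "real (card (\<C>1 \<union> \<C>2)) \<le> real (card \<C>1) + real (card \<C>2)"
        by (metis card_Un_le of_nat_add of_nat_mono)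
      ultimately have "real (card (\<C>1 \<union> \<C>2)) \<le> cost (card A) (card S)" using C1(2) C2(2) by linarith
      moreover have "\<exists>C\<in>\<C>1 \<union> \<C>2. I \<subseteq> C"
        if I: "S \<subseteq> I" "I \<subseteq> A \<union> S" "independent_set w I" "independent_set g I" for I
      proof (cases "v \<in> I")
        case True
        have "\<exists>C\<in>\<C>2. I \<subseteq> C" 
          by (rule C2(4)) (use True I g'(4) in \<open>auto simp: A'_def\<close>)
        then show ?thesis by blast
      next
        case False
        have "\<exists>C\<in>\<C>1. I \<subseteq> C" by (rule C1(4)) (use False I in \<open>auto simp: A'_def\<close>)
        then show ?thesis by blast
      qed
      ultimately show ?thesis using C1(1,3) C2(1,3) by (intro exI[of _ "\<C>1 \<union> \<C>2"]) auto
    qed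
  qed
qed

text \<open>Induction on the uniformity: the tree collects links of vertices of the independent set,
  and this set must also be independent in the collected hypergraph, whose uniformity is lower by
  one.\<close>

theorem hypergraph_containers:
  fixes \<beta> :: real and r :: nat
  assumes "0 < \<beta>"
  shows "\<exists>(c :: real) (\<tau>0 :: real). 0 < c \<and> c < 1 \<and> 0 < \<tau>0 \<and> \<tau>0 \<le> 1 \<and>
    (\<forall>(V :: 'a set) w (\<tau> :: real). finite V \<longrightarrow> 0 < \<tau> \<longrightarrow> \<tau> \<le> \<tau>0 \<longrightarrow>
    1 \<le> \<tau> * card V \<longrightarrow> weight_on V r w \<longrightarrow> (\<forall>T. T \<noteq> {} \<longrightarrow> wdeg V w T \<le> \<tau> ^ (card T - 1)) \<longrightarrow>
    \<beta> * card V \<le> wdeg V w {} \<longrightarrow>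
    (\<exists>\<C>. finite \<C> \<and> real (card \<C>) \<le> (1 / \<tau>) powr (3 * r * \<tau> * card V) \<and>
       (\<forall>C\<in>\<C>. C \<subseteq> V \<and> card C \<le> (1 - c) * card V) \<and>
       (\<forall>I\<subseteq>V. independent_set w I \<longrightarrow> (\<exists>C\<in>\<C>. I \<subseteq> C))))"
  using assms
proof (induction r arbitrary: \<beta>)
  \<comment> \<open>All the weight sits on the empty set, which every \<open>I\<close> contains.
    Positive total weight thus excludes independent sets, and the empty family works.\<close>
  case 0
  have no_independent: "\<not> independent_set w I"
    if "weight_on V 0 w" "finite V" "\<beta> * card V \<le> wdeg V w {}" "1 \<le> \<tau> * card V"
    for V I :: "'a set" and w and \<tau> :: real
  proof
    assume "independent_set w I"
    then have "w {} = 0" by (simp add: independent_set_def)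
    have "wdeg V w {} = 0" unfolding wdeg_def
    proof (intro sum.neutral ballI)
      fix e assume "e \<in> {e. e \<subseteq> V \<and> {} \<subseteq> e}"
      then show "w e = 0" using weight_on_supp[OF that(1), of e] \<open>finite V\<close> \<open>w {} = 0\<close>
        by (metis card_0_eq finite_subset)
    qed
    moreover have "card V > 0" using that(4) by (cases "card V") auto
    ultimately show False using that(3) \<open>0 < \<beta>\<close> by (simp add: mult_le_0_iff)
  qed
  show ?case
  proof (rule exI[of _ "1/2 :: real"], rule exI[of _ "1 :: real"], intro conjI allI impI)
    fix V :: "'a set" and w and \<tau> :: real
    assume V: "finite V" "1 \<le> \<tau> * card V" "weight_on V 0 w" "\<beta> * card V \<le> wdeg V w {}"
    have "\<forall>I. \<not> independent_set w I" using no_independent[OF V(3,1,4,2)] by blast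
    then show "\<exists>\<C>. finite \<C> \<and> real (card \<C>) \<le> (1 / \<tau>) powr (real (3 * 0) * \<tau> * card V) \<and>
       (\<forall>C\<in>\<C>. C \<subseteq> V \<and> card C \<le> (1 - 1 / 2 :: real) * card V) \<and>
       (\<forall>I\<subseteq>V. independent_set w I \<longrightarrow> (\<exists>C\<in>\<C>. I \<subseteq> C))"
      by (intro exI[of _ "{}"]) auto
  qed auto
next
  case (Suc r)
  define \<beta>' where "\<beta>' = \<beta> / 2 ^ (r + 3)"
  have "0 < \<beta>'" using Suc.prems by (simp add: \<beta>'_def)
  from Suc.IH[OF this] obtain c0 t0 :: real where c0: "0 < c0" "c0 < 1" and t0: "0 < t0" "t0 \<le> 1"
    and IH: "\<forall>(V :: 'a set) w (\<tau> :: real). finite V \<longrightarrow> 0 < \<tau> \<longrightarrow> \<tau> \<le> t0 \<longrightarrow>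
    1 \<le> \<tau> * card V \<longrightarrow> weight_on V r w \<longrightarrow> (\<forall>T. T \<noteq> {} \<longrightarrow> wdeg V w T \<le> \<tau> ^ (card T - 1)) \<longrightarrow>
    \<beta>' * card V \<le> wdeg V w {} \<longrightarrow>
    (\<exists>\<C>. finite \<C> \<and> real (card \<C>) \<le> (1 / \<tau>) powr (3 * r * \<tau> * card V) \<and>
       (\<forall>C\<in>\<C>. C \<subseteq> V \<and> card C \<le> (1 - c0) * card V) \<and>
       (\<forall>I\<subseteq>V. independent_set w I \<longrightarrow> (\<exists>C\<in>\<C>. I \<subseteq> C)))"
    by (elim exE conjE)
  define c where "c = min c0 (\<beta> / 4)"
  \<comment> \<open>\<open>t0\<close> serves the induction hypothesis, \<open>\<beta> / 4\<close>
    the decision tree, and \<open>exp (- 1)\<close> yields \<open>exp 1 \<le> 1 / \<tau>\<close> for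
    the count of leaves.\<close>
  define t1 where "t1 = min t0 (min (\<beta> / 4) (exp (- 1)))"
  have ct: "0 < c" "c < 1" "0 < t1" "t1 \<le> 1" using c0 t0 Suc.prems by (auto simp: c_def t1_def)
  have main: "\<exists>\<C>. finite \<C> \<and> real (card \<C>) \<le> (1 / \<tau>) powr (3 * Suc r * \<tau> * card V) \<and>
       (\<forall>C\<in>\<C>. C \<subseteq> V \<and> card C \<le> (1 - c) * card V) \<and>
       (\<forall>I\<subseteq>V. independent_set w I \<longrightarrow> (\<exists>C\<in>\<C>. I \<subseteq> C))"
    if fin: "finite V" and tau: "0 < \<tau>" "\<tau> \<le> t1" and tV: "1 \<le> \<tau> * card V"
      and w: "weight_on V (Suc r) w" and wb: "\<forall>T. T \<noteq> {} \<longrightarrow> wdeg V w T \<le> \<tau> ^ (card T - 1)"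
      and tot: "\<beta> * card V \<le> wdeg V w {}"
    for V :: "'a set" and w and \<tau> :: real
  proof -
    define Bd where "Bd = (1 / \<tau>) powr (3 * r * \<tau> * card V)"
    have tau': "\<tau> \<le> t0" "\<tau> \<le> \<beta> / 4" "\<tau> \<le> exp (- 1)" "\<tau> \<le> 1"
      using tau t0 by (auto simp: t1_def)
    have "V \<noteq> {}" using tV by auto
    have "1 \<le> Bd" unfolding Bd_def using tau tau' by (intro ge_one_powr_ge_zero) auto
    have step: "\<exists>\<C>. finite \<C> \<and> real (card \<C>) \<le> Bd \<and> (\<forall>C\<in>\<C>. C \<subseteq> V \<and> card C \<le> (1 - c) * card V) \<and>
          (\<forall>I\<subseteq>V. independent_set g I \<longrightarrow> (\<exists>C\<in>\<C>. I \<subseteq> C))"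
      if g: "weight_on V r g" and gb: "\<And>T. T \<noteq> {} \<Longrightarrow> wdeg V g T \<le> 2 * \<tau> ^ card T"
        and gt: "\<beta> / 2 ^ (r + 2) * \<tau> * card V \<le> wdeg V g {}" for g
    proof -
      \<comment> \<open>Division by \<open>2 * \<tau>\<close> restores the normalisation:
        \<open>gb\<close> becomes the bound \<open>\<tau> ^ (card T - 1)\<close> and
        \<open>gt\<close> becomes total weight \<open>\<beta>' * card V\<close>.\<close>
      define h where "h = (\<lambda>e. g e / (2 * \<tau>))"
      have wh: "wdeg V h T = wdeg V g T / (2 * \<tau>)" for T by (simp add: wdeg_def h_def sum_divide_distrib)
      have "weight_on V r h" using g tau by (auto simp: weight_on_def h_def)
      moreover have "wdeg V h T \<le> \<tau> ^ (card T - 1)" if "T \<noteq> {}" for T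
      proof (cases "T \<subseteq> V")
        case True
        then have "card T = Suc (card T - 1)" using that finite_subset[OF True fin] by (simp add: card_gt_0_iff)
        then have "2 * \<tau> ^ card T = 2 * \<tau> * \<tau> ^ (card T - 1)" by (metis mult.assoc power_Suc)
        then show ?thesis using gb[OF that] tau unfolding wh by (simp add: field_simps)
      next
        case False
        then show ?thesis using tau by (simp add: wdeg_outside)
      qed
      moreover have "\<beta>' * card V \<le> wdeg V h {}"
        using gt tau unfolding wh \<beta>'_def by (simp add: field_simps power_add)
      ultimately obtain \<C> where C: "finite \<C>" "real (card \<C>) \<le> Bd"
         "\<forall>C\<in>\<C>. C \<subseteq> V \<and> card C \<le> (1 - c0) * card V"
         "\<forall>I\<subseteq>V. independent_set h I \<longrightarrow> (\<exists>C\<in>\<C>. I \<subseteq> C)"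
        using IH[rule_format, OF fin tau(1) tau'(1) tV, of h] unfolding Bd_def by blast
      have "(1 - c0) * card V \<le> (1 - c) * card V" by (intro mult_right_mono) (auto simp: c_def)
      moreover have "independent_set h I" if "independent_set g I" for I
        using that by (simp add: independent_set_def h_def)
      ultimately show ?thesis using C by (intro exI[of _ \<C>]) force
    qed
    have "\<exists>\<C>. finite \<C> \<and>
      real (card \<C>) \<le> (1 + \<tau>) ^ card V * (1 / \<tau>) powr (\<tau> * card V + 1 - card ({} :: 'a set)) * Bd \<and>
      (\<forall>C\<in>\<C>. C \<subseteq> V \<and> card C \<le> (1 - c) * card V) \<and>
      (\<forall>I. {} \<subseteq> I \<longrightarrow> I \<subseteq> V \<union> {} \<longrightarrow> independent_set w I \<longrightarrow> independent_set (\<lambda>_. 0) I \<longrightarrow> (\<exists>C\<in>\<C>. I \<subseteq> C))"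
    proof (rule container_tree[where \<beta> = \<beta> and r = r])
      show "\<exists>\<C>. finite \<C> \<and> real (card \<C>) \<le> Bd \<and> (\<forall>C\<in>\<C>. C \<subseteq> V \<and> card C \<le> (1 - c) * card V) \<and>
          (\<forall>I\<subseteq>V. independent_set g I \<longrightarrow> (\<exists>C\<in>\<C>. I \<subseteq> C))"
        if "weight_on V r g" "\<And>T. T \<noteq> {} \<Longrightarrow> wdeg V g T \<le> 2 * \<tau> ^ card T"
          "\<beta> / 2 ^ (r + 2) * \<tau> * card V \<le> wdeg V g {}" for g
        using that by (rule step)
      show "c \<le> \<beta> / 4" by (simp add: c_def)
    qed (use fin tau tau' Suc.prems \<open>V \<noteq> {}\<close> w wb tot \<open>1 \<le> Bd\<close> in
          \<open>simp_all add: weight_on_def wdeg_def\<close>)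
    then obtain \<C> where C: "finite \<C>"
      "real (card \<C>) \<le> (1 + \<tau>) ^ card V * (1 / \<tau>) powr (\<tau> * card V + 1) * Bd"
      "\<forall>C\<in>\<C>. C \<subseteq> V \<and> card C \<le> (1 - c) * card V"
      "\<forall>I. I \<subseteq> V \<longrightarrow> independent_set w I \<longrightarrow> (\<exists>C\<in>\<C>. I \<subseteq> C)"
      by (auto simp: independent_set_def)
    have inv: "exp 1 \<le> 1 / \<tau>" "1 \<le> 1 / \<tau>"
      using tau tau' by (simp_all add: exp_minus field_simps)
    have "(1 + \<tau>) ^ card V \<le> exp \<tau> ^ card V"
      using tau by (intro power_mono) (auto simp: exp_ge_add_one_self)
    also have "\<dots> = exp 1 powr (\<tau> * card V)"
      by (simp add: powr_def exp_of_nat_mult[symmetric] mult.commute)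
    also have "\<dots> \<le> (1 / \<tau>) powr (\<tau> * card V)" using inv tau by (intro powr_mono2) auto
    finally have p1: "(1 + \<tau>) ^ card V \<le> (1 / \<tau>) powr (\<tau> * card V)" .
    \<comment> \<open>Here \<open>tV\<close> absorbs the extra 1. Each level of uniformity costs
      \<open>3 * \<tau> * card V\<close> in the exponent, one part from \<open>p1\<close> and two
      from this bound.\<close>
    have p2: "(1 / \<tau>) powr (\<tau> * card V + 1) \<le> (1 / \<tau>) powr (2 * \<tau> * card V)"
      using inv tV by (intro powr_mono) auto
    have "(1 + \<tau>) ^ card V * (1 / \<tau>) powr (\<tau> * card V + 1) * Bd
       \<le> (1 / \<tau>) powr (\<tau> * card V) * (1 / \<tau>) powr (2 * \<tau> * card V) * Bd"
      using p1 p2 \<open>1 \<le> Bd\<close> tau by (intro mult_mono) auto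
    also have "\<dots> = (1 / \<tau>) powr (3 * Suc r * \<tau> * card V)"
      unfolding Bd_def by (simp add: powr_add[symmetric] algebra_simps)
    finally show ?thesis using C by (intro exI[of _ \<C>]) auto
  qed
  show ?case
    by (rule exI[of _ c], rule exI[of _ t1], intro conjI allI impI) (rule ct | rule main, assumption+)+
qed

section \<open>Cycles and the theorem of Bondy and Simonovits\<close>

definition edges_on :: "'a set \<Rightarrow> 'a set set" where
  "edges_on V = {e. e \<subseteq> V \<and> card e = 2}"

text \<open>Cycles are edge sets because the edges of the graph are the vertices of the hypergraph.
  The map \<open>f\<close> lists the vertices in cyclic order.\<close>

definition cycles_in :: "nat \<Rightarrow> 'a set set \<Rightarrow> 'a set set set" where
  "cycles_in k E = {C. C \<subseteq> E \<and> (\<exists>f. inj_on f {..<k} \<and> C = (\<lambda>i. {f i, f (Suc i mod k)}) ` {..<k})}"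

lemma finite_edges_on: "finite V \<Longrightarrow> finite (edges_on V)"
  by (simp add: edges_on_def)

lemma finite_cycles_in: "finite E \<Longrightarrow> finite (cycles_in k E)"
  by (rule finite_subset[of _ "Pow E"]) (auto simp: cycles_in_def)

lemma cycles_in_mono: "E \<subseteq> E' \<Longrightarrow> cycles_in k E \<subseteq> cycles_in k E'"
  by (auto simp: cycles_in_def)

text \<open>If two indices gave the same edge, each would be the cyclic successor of the other,
  which happens only for \<open>k = 2\<close>.\<close>

lemma inj_on_cycle_edges:
  assumes "3 \<le> k" "inj_on f {..<k}"
  shows "inj_on (\<lambda>i. {f i, f (Suc i mod k)}) {..<k}"
proof (rule inj_onI)
  fix i j assume ij: "i \<in> {..<k}" "j \<in> {..<k}" and eq: "{f i, f (Suc i mod k)} = {f j, f (Suc j mod k)}"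
  have m: "Suc i mod k \<in> {..<k}" "Suc j mod k \<in> {..<k}" using assms(1) by auto
  show "i = j"
  proof (rule ccontr)
    assume "i \<noteq> j"
    then have "f i \<noteq> f j" using ij inj_onD[OF assms(2)] by blast
    then have "f i = f (Suc j mod k)" "f j = f (Suc i mod k)" using eq by (auto simp: doubleton_eq_iff)
    then have "i = Suc j mod k" "j = Suc i mod k" using ij m inj_onD[OF assms(2)] by blast+
    then have "Suc j = k \<and> i = 0 \<or> i = Suc j" "Suc i = k \<and> j = 0 \<or> j = Suc i"
      using ij by (metis lessThan_iff mod_less mod_self Suc_lessI)+
    then show False using assms(1) by arith
  qed
qed

lemma cycles_in_card: "3 \<le> k \<Longrightarrow> C \<in> cycles_in k E \<Longrightarrow> card C = k"
  unfolding cycles_in_def using card_image[OF inj_on_cycle_edges, of k] by fastforce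

lemma successor_closed_full:
  assumes J: "J \<subseteq> {..<k}" "J \<noteq> {}" and closed: "(\<lambda>i. Suc i mod k) ` J \<subseteq> J"
  shows "J = {..<k}"
proof -
  obtain i where i: "i \<in> J" using J by blast
  then have "i < k" using J by auto
  have "(i + j) mod k \<in> J" for j
  proof (induction j)
    case 0
    then show ?case using i \<open>i < k\<close> by simp
  next
    case (Suc j)
    then have "Suc ((i + j) mod k) mod k \<in> J" using closed by blast
    then show ?case by (simp add: mod_Suc_eq)
  qed
  then have shift: "(i + (k - i + m)) mod k \<in> J" for m .
  have "m \<in> J" if "m < k" for m using shift[of m] that \<open>i < k\<close> by simp
  then show ?thesis using J by auto
qed

text \<open>The endpoints are indexed by \<open>J\<close> and its successors. Without a new index
  among the successors, \<open>J\<close> is closed under succession and hence the full cycle, which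
  explains the minimum with \<open>k\<close>.\<close>

lemma card_Union_cycle_subset:
  assumes "3 \<le> k" and C: "C \<in> cycles_in k E" and T: "T \<subseteq> C" "T \<noteq> {}"
  shows "min (Suc (card T)) k \<le> card (\<Union>T)"
proof -
  obtain f where f: "inj_on f {..<k}" and Cf: "C = (\<lambda>i. {f i, f (Suc i mod k)}) ` {..<k}"
    using C by (auto simp: cycles_in_def)
  obtain J where J: "J \<subseteq> {..<k}" and TJ: "T = (\<lambda>i. {f i, f (Suc i mod k)}) ` J"
    using T(1) unfolding Cf by (elim subset_imageE)
  define s where "s = (\<lambda>i. Suc i mod k)"
  have finJ: "finite J" using J finite_subset by blast
  have cT: "card T = card J"
    unfolding TJ using inj_on_subset[OF inj_on_cycle_edges[OF assms(1) f] J] by (rule card_image)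
  have sJ: "J \<union> s ` J \<subseteq> {..<k}" using J assms(1) by (auto simp: s_def)
  have "\<Union>T = f ` (J \<union> s ` J)" unfolding TJ s_def by auto
  then have cU: "card (\<Union>T) = card (J \<union> s ` J)"
    using inj_on_subset[OF f sJ] by (simp add: card_image)
  show ?thesis
  proof (cases "s ` J \<subseteq> J")
    case True
    then have "J = {..<k}" using successor_closed_full[of J k] J T TJ by (auto simp: s_def)
    then show ?thesis unfolding cU using card_mono[of "J \<union> s ` J" J] finJ by simp
  next
    case False
    then have "card J < card (J \<union> s ` J)" using finJ by (intro psubset_card_mono) auto
    then show ?thesis using cU cT by simp
  qed
qed

section \<open>Cycles closed through a tree\<close>

lemma successively_conv_nth:
  "successively P xs \<longleftrightarrow> (\<forall>i. Suc i < length xs \<longrightarrow> P (xs ! i) (xs ! Suc i))"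
proof (induction xs rule: induct_list012)
  case (3 x y zs)
  then show ?case by (auto simp: nth_Cons split: nat.splits)
qed auto

lemma closed_path_cycle:
  assumes xs: "distinct xs" "length xs = k" "k \<noteq> 0" "successively (\<lambda>u v. {u, v} \<in> E) xs" "{last xs, hd xs} \<in> E"
  shows "cycles_in k E \<noteq> {}"
proof -
  have "{xs ! i, xs ! (Suc i mod k)} \<in> E" if "i < k" for i
  proof (cases "Suc i = k")
    case True
    then have "last xs = xs ! i" "hd xs = xs ! 0" 
      using xs(2) last_conv_nth[of xs] hd_conv_nth[of xs] by (metis diff_Suc_1 length_0_conv nat.distinct(1))+
    then show ?thesis using xs(5) True by simp
  next
    case False
    then show ?thesis using xs(2,4) that by (simp add: successively_conv_nth)
  qed
  moreover have "inj_on ((!) xs) {..<k}" using xs by (auto simp: inj_on_nth)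
  ultimately have "(\<lambda>i. {xs ! i, xs ! (Suc i mod k)}) ` {..<k} \<in> cycles_in k E"
    unfolding cycles_in_def by blast
  then show ?thesis by blast
qed

text \<open>The path grows at its head, which has more than \<open>D\<close> neighbours in
  \<open>U\<close>, while the path and \<open>Z\<close> block at most \<open>D\<close> vertices.
  \<open>P\<close> carries an invariant of the head; in the application it records the side and the
  ancestor.\<close>

lemma greedy_path:
  assumes deg: "\<And>v. v \<in> U \<Longrightarrow> D < card {u \<in> U. {v, u} \<in> F}" and "finite Z"
    and y: "y \<in> U" "y \<notin> Z" "P 0 y"
    and step: "\<And>n u w. P n u \<Longrightarrow> u \<in> U \<Longrightarrow> w \<in> U \<Longrightarrow> {u, w} \<in> F \<Longrightarrow> P (Suc n) w"
  shows "n + card Z \<le> D \<Longrightarrow> \<exists>xs. length xs = Suc n \<and> last xs = y \<and> distinct xs \<and> set xs \<subseteq> U - Z \<and>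
    successively (\<lambda>u v. {u, v} \<in> F) xs \<and> P n (hd xs)"
proof (induction n)
  case 0
  then show ?case using y by (intro exI[of _ "[y]"]) auto
next
  case (Suc n)
  then obtain xs where xs: "length xs = Suc n" "last xs = y" "distinct xs" "set xs \<subseteq> U - Z"
    "successively (\<lambda>u v. {u, v} \<in> F) xs" "P n (hd xs)" by auto
  have ne: "xs \<noteq> []" using xs(1) by auto
  then have hU: "hd xs \<in> U" using xs(4) hd_in_set[of xs] by blast
  have "card (set xs \<union> Z) \<le> card (set xs) + card Z" by (rule card_Un_le)
  also have "\<dots> \<le> D" using Suc.prems xs(1) card_length[of xs] by linarith
  also have "\<dots> < card {u \<in> U. {hd xs, u} \<in> F}" by (rule deg[OF hU])
  finally have "\<not> {u \<in> U. {hd xs, u} \<in> F} \<subseteq> set xs \<union> Z"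
    using \<open>finite Z\<close> by (meson List.finite_set card_mono finite_UnI not_le)
  then obtain w where w: "w \<in> U" "{hd xs, w} \<in> F" "w \<notin> set xs" "w \<notin> Z" by blast
  have "P (Suc n) w" using step[OF xs(6) hU w(1,2)] .
  then show ?case using xs w ne
    by (intro exI[of _ "w # xs"]) (auto simp: successively_Cons insert_commute)
qed

text \<open>Let \<open>t\<close> be minimal such that the neighbours of every \<open>y\<close> have a common ancestor \<open>t\<close> levels up. By
  minimality some \<open>y0\<close> has neighbours \<open>a\<close> and \<open>b\<close> with different ancestors \<open>t - 1\<close> levels up. A path of
  length \<open>2 * (l - t) - 1\<close> from \<open>y0\<close> that avoids \<open>a\<close> and \<open>b\<close> ends in a vertex \<open>z\<close> of level \<open>i\<close>, whose
  ancestor \<open>t - 1\<close> levels up differs from that of \<open>a\<close> or of \<open>b\<close>. Through that neighbour, the tree paths to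
  the common ancestor close the path to a cycle of length \<open>2 * l\<close>.\<close>

lemma layer_cycle:
  fixes lev :: "'a \<Rightarrow> nat" and \<pi> :: "'a \<Rightarrow> 'a"
  assumes l: "2 \<le> l" and il: "i < l"
    and E2: "\<And>e. e \<in> E \<Longrightarrow> card e = 2"
    and root: "\<And>v. v \<in> W \<Longrightarrow> lev v = 0 \<Longrightarrow> v = r"
    and par: "\<And>v. v \<in> W \<Longrightarrow> 0 < lev v \<Longrightarrow> \<pi> v \<in> W \<and> {v, \<pi> v} \<in> E \<and> Suc (lev (\<pi> v)) = lev v"
    and F: "F \<subseteq> E" and U: "U \<subseteq> W" and levU: "\<And>u. u \<in> U \<Longrightarrow> i \<le> lev u"
    and deg: "\<And>v. v \<in> U \<Longrightarrow> 2 * l < card {u \<in> U. {v, u} \<in> F}"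
    and twostep: "\<And>x y x'. x \<in> U \<Longrightarrow> y \<in> U \<Longrightarrow> x' \<in> U \<Longrightarrow> lev x = i \<Longrightarrow> {x, y} \<in> F \<Longrightarrow> {y, x'} \<in> F \<Longrightarrow> lev x' = i"
    and x0: "x0 \<in> U" "lev x0 = i"
  shows "cycles_in (2 * l) E \<noteq> {}"
proof -
  define N where "N = (\<lambda>v. {u \<in> U. {v, u} \<in> F})"
  \<comment> \<open>Edges inside one level and edges between two consecutive levels are treated
    together: in the first case \<open>X\<close> and \<open>Y\<close> coincide, in the second they
    lie in the two levels. \<open>twostep\<close> holds in both.\<close>
  define X where "X = {u \<in> U. lev u = i}"
  define Y where "Y = {y \<in> U. \<exists>x\<in>X. {x, y} \<in> F}"
  have NY: "N y \<subseteq> X" if "y \<in> Y" for y using that twostep by (auto simp: N_def X_def Y_def)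
  have NX: "N x \<subseteq> Y" if "x \<in> X" for x using that by (auto simp: N_def Y_def)
  have N_sym: "u \<in> N v" if "v \<in> N u" "u \<in> U" for u v using that by (auto simp: N_def insert_commute)
  have N_ne: "v \<notin> N v" for v using F E2 by (force simp: N_def)
  have pi_iter: "(\<pi> ^^ j) v \<in> W \<and> lev ((\<pi> ^^ j) v) = lev v - j" if "v \<in> W" "j \<le> lev v" for j v
    using that
  proof (induction j)
    case (Suc j)
    then have "(\<pi> ^^ j) v \<in> W" "lev ((\<pi> ^^ j) v) = lev v - j" by auto
    with par[of "(\<pi> ^^ j) v"] Suc.prems show ?case by auto
  qed simp
  define const where "const = (\<lambda>t. \<forall>y\<in>Y. \<forall>a\<in>N y. \<forall>b\<in>N y. (\<pi> ^^ t) a = (\<pi> ^^ t) b)"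
  have "const i" unfolding const_def
  proof (intro ballI)
    fix y a b assume "y \<in> Y" "a \<in> N y" "b \<in> N y"
    then have "a \<in> X" "b \<in> X" using NY by blast+
    then have "a \<in> W" "b \<in> W" "lev a = i" "lev b = i" using U by (auto simp: X_def)
    then have "(\<pi> ^^ i) a = r" "(\<pi> ^^ i) b = r" using pi_iter[of a i] pi_iter[of b i] root by auto
    then show "(\<pi> ^^ i) a = (\<pi> ^^ i) b" by simp
  qed
  have "\<not> const 0"
  proof
    assume c0: "const 0"
    have x0X: "x0 \<in> X" using x0 by (simp add: X_def)
    have "0 < card (N x0)" using deg[OF x0(1)] by (simp add: N_def)
    then obtain y where y: "y \<in> N x0" by (metis card.empty equals0I less_irrefl)
    then have "y \<in> Y" using NX[OF x0X] by blast
    then have "\<forall>a\<in>N y. \<forall>b\<in>N y. a = b" using c0 by (auto simp: const_def)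
    then have "N y \<subseteq> {SOME a. a \<in> N y}" by (metis singletonI someI subsetI)
    then have "card (N y) \<le> card {SOME a. a \<in> N y}" by (intro card_mono) auto
    moreover have "2 * l < card (N y)" using deg[of y] \<open>y \<in> Y\<close> by (simp add: N_def Y_def)
    ultimately show False using l by simp
  qed
  define t where "t = (LEAST t. const t)"
  have t: "const t" "t \<le> i" using \<open>const i\<close> by (auto simp: t_def intro: LeastI Least_le)
  have const_t: "(\<pi> ^^ t) u = (\<pi> ^^ t) v" if "y \<in> Y" "u \<in> N y" "v \<in> N y" for u v y
    using t(1) that unfolding const_def by blast
  have "t \<noteq> 0" using \<open>\<not> const 0\<close> t(1) by metis
  then obtain s where s: "t = Suc s" by (cases t) auto
  have "\<not> const s" using s not_less_Least[of s const] by (simp add: t_def)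
  then obtain y0 a b where y0: "y0 \<in> Y" and ab: "a \<in> N y0" "b \<in> N y0" "(\<pi> ^^ s) a \<noteq> (\<pi> ^^ s) b"
    by (auto simp: const_def)
  \<comment> \<open>The path alternates between \<open>Y\<close> and \<open>X\<close>. All
    neighbours of a vertex of \<open>Y\<close> share their ancestor \<open>t\<close> levels up, so
    along the path it remains that of \<open>a\<close>.\<close>
  define P where "P = (\<lambda>(n :: nat) u. (odd n \<longrightarrow> u \<in> X \<and> (\<pi> ^^ t) u = (\<pi> ^^ t) a) \<and>
     (even n \<longrightarrow> u \<in> Y \<and> (\<forall>w\<in>N u. (\<pi> ^^ t) w = (\<pi> ^^ t) a)))"
  \<comment> \<open>The path has \<open>2 * (l - t)\<close> vertices, \<open>up\<close> has
    \<open>t + 1\<close> and \<open>down\<close> has \<open>t - 1\<close>, in total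
    \<open>2 * l\<close>. Since \<open>n\<close> is odd, the path ends in \<open>X\<close>.\<close>
  define n where "n = 2 * (l - t) - 1"
  have n: "odd n" "Suc n + 2 * t = 2 * l" "n + 2 \<le> 2 * l"
    using t(2) il \<open>t \<noteq> 0\<close> by (auto simp: n_def)
  have "\<exists>xs. length xs = Suc n \<and> last xs = y0 \<and> distinct xs \<and> set xs \<subseteq> U - {a, b} \<and>
    successively (\<lambda>u v. {u, v} \<in> F) xs \<and> P n (hd xs)"
  proof (rule greedy_path[OF deg])
    show "y0 \<in> U" "y0 \<notin> {a, b}" using y0 ab N_ne by (auto simp: Y_def)
    show "P 0 y0" using y0 const_t[OF y0 _ ab(1)] by (simp add: P_def)
    show "P (Suc m) w" if "P m u" "u \<in> U" "w \<in> U" "{u, w} \<in> F" for m u w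
    proof (cases "odd m")
      case True
      then have "u \<in> X" "(\<pi> ^^ t) u = (\<pi> ^^ t) a" using that(1) by (auto simp: P_def)
      moreover have wN: "w \<in> N u" using that by (simp add: N_def)
      ultimately have "w \<in> Y" using NX by blast
      moreover have "u \<in> N w" using N_sym[OF wN that(2)] .
      ultimately show ?thesis
        using const_t[of w _ u] \<open>(\<pi> ^^ t) u = (\<pi> ^^ t) a\<close> True by (simp add: P_def)
    next
      case False
      then have "u \<in> Y" "w \<in> N u" "\<forall>w\<in>N u. (\<pi> ^^ t) w = (\<pi> ^^ t) a"
        using that by (auto simp: P_def N_def)
      then show ?thesis using False NY[of u] unfolding P_def by auto
    qed
    have "card {a, b} \<le> 2" by (simp add: card_insert_if)
    then show "n + card {a, b} \<le> 2 * l" using n(3) by linarith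
  qed auto
  then obtain xs where xs: "length xs = Suc n" "last xs = y0" "distinct xs" "set xs \<subseteq> U - {a, b}"
    "successively (\<lambda>u v. {u, v} \<in> F) xs" "P n (hd xs)" by blast
  define z where "z = hd xs"
  have z: "z \<in> X" "(\<pi> ^^ t) z = (\<pi> ^^ t) a" using xs(6) n(1) by (auto simp: P_def z_def)
  obtain c where c: "c \<in> {a, b}" "(\<pi> ^^ s) c \<noteq> (\<pi> ^^ s) z" using ab(3) by (metis insertCI)
  have cN: "c \<in> N y0" using c ab by auto
  have cX: "c \<in> X" using NY[OF y0] cN by blast
  have tc: "(\<pi> ^^ t) c = (\<pi> ^^ t) z" using const_t[OF y0 cN ab(1)] z(2) by simp
  have cW: "c \<in> W" "lev c = i" and zW: "z \<in> W" "lev z = i" using cX z U by (auto simp: X_def)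
  have ne: "xs \<noteq> []" using xs(1) by auto
  \<comment> \<open>\<open>up\<close> contains both \<open>c\<close> and the common ancestor.
    \<open>down\<close> omits the ancestor and also \<open>z\<close>, which is the head of
    \<open>xs\<close>; for \<open>t = 1\<close> it is empty.\<close>
  define up where "up = map (\<lambda>j. (\<pi> ^^ j) c) [0..<Suc t]"
  define down where "down = rev (map (\<lambda>j. (\<pi> ^^ j) z) [1..<t])"
  have set_up: "set up = (\<lambda>j. (\<pi> ^^ j) c) ` {..t}"
    unfolding up_def set_map set_upt by (simp only: atLeastLessThanSuc_atLeastAtMost atLeast0AtMost)
  have set_down: "set down = (\<lambda>j. (\<pi> ^^ j) z) ` {1..<t}" unfolding down_def by auto
  have lev_iter: "lev ((\<pi> ^^ j) c) = i - j" "lev ((\<pi> ^^ j) z) = i - j" if "j \<le> t" for j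
    using pi_iter[of c j] pi_iter[of z j] cW zW that t(2) by auto
  have distinct_iter: "(\<pi> ^^ j) c \<noteq> (\<pi> ^^ j) z" if "j \<le> s" for j
  proof
    assume "(\<pi> ^^ j) c = (\<pi> ^^ j) z"
    then have "(\<pi> ^^ (s - j)) ((\<pi> ^^ j) c) = (\<pi> ^^ (s - j)) ((\<pi> ^^ j) z)" by simp
    then show False using c(2) that by (simp flip: funpow_add[unfolded o_def, THEN fun_cong])
  qed
  have step_edge: "{(\<pi> ^^ j) v, (\<pi> ^^ Suc j) v} \<in> E" if "v \<in> W" "lev v = i" "j < t" for v j
    using par[of "(\<pi> ^^ j) v"] pi_iter[of v j] that t(2) by auto
  have xs_lev: "i \<le> lev u" if "u \<in> set xs" for u using that xs(4) levU by auto
  have "distinct (xs @ up @ down)"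
  proof -
    have inj: "inj_on (\<lambda>j. (\<pi> ^^ j) v) {0..t}" if "v = c \<or> v = z" for v
    proof (rule inj_onI)
      fix j k assume jk: "j \<in> {0..t}" "k \<in> {0..t}" "(\<pi> ^^ j) v = (\<pi> ^^ k) v"
      then have "i - j = i - k" using lev_iter that by (metis atLeastAtMost_iff)
      then show "j = k" using jk t(2) by auto
    qed
    have "distinct up" using inj[of c] unfolding up_def distinct_map
      by (simp add: atLeastLessThanSuc_atLeastAtMost del: upt_Suc)
    moreover have "inj_on (\<lambda>j. (\<pi> ^^ j) z) {1..<t}" by (rule inj_on_subset[OF inj[of z]]) auto
    then have "distinct down" unfolding down_def distinct_rev distinct_map by simp
    moreover have "set up \<inter> set down = {}"
    proof -
      have "(\<pi> ^^ j) c \<noteq> (\<pi> ^^ k) z" if "j \<le> t" "k < t" for j k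
      proof
        assume eq: "(\<pi> ^^ j) c = (\<pi> ^^ k) z"
        then have "i - j = i - k" using lev_iter that by (metis less_imp_le)
        then have "j = k" using that t(2) by linarith
        then show False using distinct_iter[of k] that s eq by auto
      qed
      then show ?thesis unfolding set_up set_down by auto
    qed
    moreover have "set xs \<inter> set up = {}"
    proof -
      have "(\<pi> ^^ j) c \<notin> set xs" if "j \<le> t" for j
      proof (cases "j = 0")
        case True
        then show ?thesis using c(1) xs(4) by auto
      next
        case False
        then show ?thesis using xs_lev[of "(\<pi> ^^ j) c"] lev_iter(1)[OF that] that t(2) by auto
      qed
      then show ?thesis unfolding set_up by auto
    qed
    moreover have "set xs \<inter> set down = {}"
    proof -
      have "(\<pi> ^^ j) z \<notin> set xs" if "1 \<le> j" "j < t" for j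
        using xs_lev[of "(\<pi> ^^ j) z"] lev_iter(2)[of j] that t(2) by auto
      then show ?thesis unfolding set_down by auto
    qed
    ultimately show ?thesis using xs(3) by auto
  qed
  moreover have "length (xs @ up @ down) = 2 * l"
    using xs(1) n(2) \<open>t \<noteq> 0\<close> by (simp add: up_def down_def)
  moreover have "successively (\<lambda>u v. {u, v} \<in> E) (xs @ up @ down)"
  proof -
    have "successively (\<lambda>u v. {u, v} \<in> E) xs" using xs(5) F by (auto intro: successively_mono)
    moreover have "successively (\<lambda>u v. {u, v} \<in> E) up"
      unfolding up_def successively_conv_nth using step_edge[OF cW]
      by (auto simp del: upt_Suc funpow.simps)
    moreover have "successively (\<lambda>u v. {u, v} \<in> E) down"
      unfolding down_def successively_rev unfolding successively_conv_nth using step_edge[OF zW]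
      by (auto simp: insert_commute simp del: funpow.simps)
    moreover have "{last xs, hd up} \<in> E"
      using xs(2) cN F by (auto simp: up_def N_def hd_map simp del: upt_Suc)
    moreover have "{last up, hd down} \<in> E" if "down \<noteq> []"
    proof -
      have "1 < t" using that by (simp add: down_def)
      then have "last up = (\<pi> ^^ Suc s) z" "hd down = (\<pi> ^^ s) z"
        using tc s by (auto simp: up_def down_def last_map hd_rev simp del: funpow.simps)
      then show ?thesis using step_edge[OF zW, of s] s by (simp add: insert_commute)
    qed
    moreover have "up \<noteq> []" by (simp add: up_def)
    ultimately show ?thesis using ne by (auto simp: successively_append_iff)
  qed
  moreover have "{last (xs @ up @ down), hd (xs @ up @ down)} \<in> E"
  proof (cases "down = []")
    case True
    then have "t = 1" using \<open>t \<noteq> 0\<close> by (simp add: down_def)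
    then have "last (xs @ up @ down) = (\<pi> ^^ Suc 0) z" using True tc by (simp add: up_def)
    then show ?thesis using step_edge[OF zW, of 0] \<open>t = 1\<close> ne by (simp add: z_def insert_commute)
  next
    case False
    then have "1 < t" by (simp add: down_def)
    then have "last (xs @ up @ down) = (\<pi> ^^ Suc 0) z"
      using False by (simp add: down_def last_rev hd_map)
    then show ?thesis using step_edge[OF zW, of 0] \<open>1 < t\<close> ne by (simp add: z_def insert_commute)
  qed
  ultimately show ?thesis using l by (intro closed_path_cycle) auto
qed

section \<open>Breadth-first layers and the edge bound\<close>

lemma finite_subset_edges_on: "finite V \<Longrightarrow> E \<subseteq> edges_on V \<Longrightarrow> finite E"
  using finite_edges_on finite_subset by blast

lemma edges_on_empty [simp]: "edges_on {} = {}"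
  by (auto simp: edges_on_def)

text \<open>Deleting a vertex with at most \<open>d\<close> neighbours loses at most
  \<open>d\<close> edges, so the strict inequality persists; it fails for the empty vertex set,
  hence the deletion stops earlier.\<close>

lemma min_degree_subgraph:
  assumes "finite V" "F \<subseteq> edges_on V" "d * card V < card F"
  shows "\<exists>U\<subseteq>V. U \<noteq> {} \<and> (\<forall>v\<in>U. d < card {u \<in> U. {v, u} \<in> F})"
  using assms
proof (induction "card V" arbitrary: V F)
  case 0
  then show ?case by auto
next
  case (Suc n)
  show ?case
  proof (cases "\<forall>v\<in>V. d < card {u \<in> V. {v, u} \<in> F}")
    case True
    then show ?thesis using Suc.hyps(2) by (intro exI[of _ V]) auto
  next
    case False
    then obtain v where v: "v \<in> V" "card {u \<in> V. {v, u} \<in> F} \<le> d" by force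
    define F' where "F' = {e \<in> F. v \<notin> e}"
    have finF: "finite F" using Suc.prems finite_subset_edges_on by blast
    have "{e \<in> F. v \<in> e} \<subseteq> (\<lambda>u. {v, u}) ` {u \<in> V. {v, u} \<in> F}"
    proof
      fix e assume e: "e \<in> {e \<in> F. v \<in> e}"
      then have "card e = 2" "e \<subseteq> V" using Suc.prems by (auto simp: edges_on_def)
      then obtain u where "e = {v, u}" using e by (auto simp: card_2_iff)
      then show "e \<in> (\<lambda>u. {v, u}) ` {u \<in> V. {v, u} \<in> F}" using e \<open>e \<subseteq> V\<close> by auto
    qed
    then have "card {e \<in> F. v \<in> e} \<le> d"
      using surj_card_le[of "{u \<in> V. {v, u} \<in> F}"] v(2) Suc.prems(1) by fastforce
    moreover have "F = F' \<union> {e \<in> F. v \<in> e}" by (auto simp: F'_def)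
    then have "card F \<le> card F' + card {e \<in> F. v \<in> e}" using card_Un_le[of F' "{e \<in> F. v \<in> e}"] by simp
    moreover have cV: "card V = Suc (card (V - {v}))" using card_Suc_Diff1[OF Suc.prems(1) v(1)] by simp
    ultimately have less: "d * card (V - {v}) < card F'" using Suc.prems(3) by simp
    have "F' \<subseteq> edges_on (V - {v})" using Suc.prems(2) by (auto simp: F'_def edges_on_def)
    then obtain U where U: "U \<subseteq> V - {v}" "U \<noteq> {}" "\<forall>x\<in>U. d < card {u \<in> U. {x, u} \<in> F'}"
      using Suc.hyps(1)[of "V - {v}" F'] Suc.hyps(2) cV Suc.prems(1) less by auto
    have "d < card {u \<in> U. {x, u} \<in> F}" if "x \<in> U" for x
    proof -
      have "finite U" using U(1) Suc.prems(1) finite_subset by blast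
      then have "card {u \<in> U. {x, u} \<in> F'} \<le> card {u \<in> U. {x, u} \<in> F}"
        by (intro card_mono) (auto simp: F'_def)
      then show ?thesis using U(3) that by fastforce
    qed
    then show ?thesis using U(1,2) by (intro exI[of _ U]) auto
  qed
qed

text \<open>\<open>W\<close> is the component of \<open>r\<close> and \<open>lev\<close> the
  distance from \<open>r\<close>. Read for both orders of an edge, the last clause says that
  adjacent vertices differ by at most one level.\<close>

lemma bfs_tree:
  obtains W :: "'a set" and lev :: "'a \<Rightarrow> nat" and \<pi> :: "'a \<Rightarrow> 'a" where
    "r \<in> W" "lev r = 0" "\<And>v. v \<in> W \<Longrightarrow> lev v = 0 \<Longrightarrow> v = r"
    "\<And>v. v \<in> W \<Longrightarrow> 0 < lev v \<Longrightarrow> \<pi> v \<in> W \<and> {v, \<pi> v} \<in> E \<and> Suc (lev (\<pi> v)) = lev v"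
    "\<And>u v. u \<in> W \<Longrightarrow> {u, v} \<in> E \<Longrightarrow> v \<in> W \<and> lev v \<le> Suc (lev u)"
proof -
  define R where "R = {(u, v). {u, v} \<in> E}"
  define W where "W = {v. \<exists>n. (r, v) \<in> R ^^ n}"
  define lev where "lev = (\<lambda>v. LEAST n. (r, v) \<in> R ^^ n)"
  have lev: "(r, v) \<in> R ^^ lev v" if "v \<in> W" for v
    using that unfolding W_def lev_def by (auto intro: LeastI)
  have lev_le: "v \<in> W \<and> lev v \<le> n" if "(r, v) \<in> R ^^ n" for v n
    using that unfolding W_def lev_def by (auto intro: Least_le)
  have adj: "v \<in> W \<and> lev v \<le> Suc (lev u)" if "u \<in> W" "{u, v} \<in> E" for u v
    using lev_le[of v "Suc (lev u)"] lev[OF that(1)] that(2) by (auto simp: R_def)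
  have "\<exists>u. u \<in> W \<and> {v, u} \<in> E \<and> Suc (lev u) = lev v" if v: "v \<in> W" "0 < lev v" for v
  proof -
    obtain n where n: "lev v = Suc n" using v(2) by (cases "lev v") auto
    then have "(r, v) \<in> R ^^ Suc n" using lev[OF v(1)] by simp
    then obtain u where u: "(r, u) \<in> R ^^ n" "{u, v} \<in> E" by (auto simp: R_def)
    then have "u \<in> W" "lev u \<le> n" using lev_le by blast+
    moreover have "lev v \<le> Suc (lev u)" using adj[OF \<open>u \<in> W\<close> u(2)] by blast
    ultimately show ?thesis using n u(2) by (intro exI[of _ u]) (auto simp: insert_commute)
  qed
  then obtain \<pi> where \<pi>: "\<And>v. v \<in> W \<Longrightarrow> 0 < lev v \<Longrightarrow> \<pi> v \<in> W \<and> {v, \<pi> v} \<in> E \<and> Suc (lev (\<pi> v)) = lev v"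
    by metis
  have "r \<in> W" "lev r = 0" using lev_le[of r 0] by auto
  moreover have "v = r" if "v \<in> W" "lev v = 0" for v using lev[OF that(1)] that(2) by simp
  ultimately show thesis using that \<pi> adj by blast
qed

text \<open>More edges would leave a subgraph of minimum degree above \<open>2 * l\<close>, in which
  \<open>layer_cycle\<close> finds the forbidden cycle.\<close>

lemma layer_edges_bound:
  fixes lev :: "'a \<Rightarrow> nat" and \<pi> :: "'a \<Rightarrow> 'a"
  assumes l: "2 \<le> l" and il: "i < l" and E: "E \<subseteq> edges_on V"
    and free: "cycles_in (2 * l) E = {}"
    and root: "\<And>v. v \<in> W \<Longrightarrow> lev v = 0 \<Longrightarrow> v = r"
    and par: "\<And>v. v \<in> W \<Longrightarrow> 0 < lev v \<Longrightarrow> \<pi> v \<in> W \<and> {v, \<pi> v} \<in> E \<and> Suc (lev (\<pi> v)) = lev v"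
    and F: "F \<subseteq> E" and Y: "Y \<subseteq> W" "finite Y" and FY: "F \<subseteq> edges_on Y" and levY: "\<And>u. u \<in> Y \<Longrightarrow> i \<le> lev u"
    and meets: "\<And>e. e \<in> F \<Longrightarrow> \<exists>u\<in>e. lev u = i"
    and twostep: "\<And>x y x'. lev x = i \<Longrightarrow> {x, y} \<in> F \<Longrightarrow> {y, x'} \<in> F \<Longrightarrow> lev x' = i"
  shows "card F \<le> 2 * l * card Y"
proof (rule ccontr)
  assume "\<not> ?thesis"
  then obtain U where U: "U \<subseteq> Y" "U \<noteq> {}" "\<forall>v\<in>U. 2 * l < card {u \<in> U. {v, u} \<in> F}"
    using min_degree_subgraph[OF Y(2) FY, of "2 * l"] by auto
  obtain v where v: "v \<in> U" using U(2) by blast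
  then have "0 < card {u \<in> U. {v, u} \<in> F}" using U(3) by fastforce
  then obtain u where "u \<in> U" "{v, u} \<in> F" by (metis (mono_tags, lifting) Collect_empty_eq card.empty less_irrefl)
  then obtain x0 where x0: "x0 \<in> U" "lev x0 = i" using meets[of "{v, u}"] v by auto
  have "cycles_in (2 * l) E \<noteq> {}"
  proof (rule layer_cycle[OF l il _ root par F _ _ _ _ x0])
    show "card e = 2" if "e \<in> E" for e using that E by (auto simp: edges_on_def)
    show "U \<subseteq> W" using U Y by blast
    show "i \<le> lev u" if "u \<in> U" for u using that U levY by blast
    show "2 * l < card {u \<in> U. {v, u} \<in> F}" if "v \<in> U" for v using that U(3) by blast
    show "lev x' = i" if "lev x = i" "{x, y} \<in> F" "{y, x'} \<in> F" for x y x' using twostep that by blast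
  qed
  with free show False by blast
qed

lemma min_degree_even_cycle_free:
  assumes l: "2 \<le> l" and q: "1 \<le> q" and fin: "finite V" and "V \<noteq> {}" and E: "E \<subseteq> edges_on V"
    and free: "cycles_in (2 * l) E = {}"
    and deg: "\<And>v. v \<in> V \<Longrightarrow> 4 * l * (q + 4) \<le> card {u \<in> V. {v, u} \<in> E}"
  shows "q ^ l \<le> card V"
proof -
  obtain r where r: "r \<in> V" using \<open>V \<noteq> {}\<close> by blast
  obtain W :: "'a set" and lev :: "'a \<Rightarrow> nat" and \<pi> :: "'a \<Rightarrow> 'a" where
    rW: "r \<in> W" "lev r = 0" and root: "\<And>v. v \<in> W \<Longrightarrow> lev v = 0 \<Longrightarrow> v = r"
    and par: "\<And>v. v \<in> W \<Longrightarrow> 0 < lev v \<Longrightarrow> \<pi> v \<in> W \<and> {v, \<pi> v} \<in> E \<and> Suc (lev (\<pi> v)) = lev v"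
    and adj: "\<And>u v. u \<in> W \<Longrightarrow> {u, v} \<in> E \<Longrightarrow> v \<in> W \<and> lev v \<le> Suc (lev u)"
    using bfs_tree[of r E] by blast
  have WV: "W \<subseteq> V"
  proof
    fix v assume "v \<in> W"
    show "v \<in> V"
    proof (cases "lev v = 0")
      case True
      then show ?thesis using root \<open>v \<in> W\<close> r by blast
    next
      case False
      then have "{v, \<pi> v} \<in> E" using par \<open>v \<in> W\<close> by blast
      then show ?thesis using E by (auto simp: edges_on_def)
    qed
  qed
  have finE: "finite E" using finite_subset_edges_on[OF fin E] .
  define L where "L = (\<lambda>j. {v \<in> W. lev v = j})"
  have finL: "finite (L j)" for j using WV fin finite_subset unfolding L_def by fastforce
  define inner where "inner = (\<lambda>j. {e \<in> E. e \<subseteq> L j})"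
  define outer where "outer = (\<lambda>j. {e \<in> E. \<exists>x\<in>L j. \<exists>y\<in>L (Suc j). e = {x, y}})"
  have edge_cases: "e \<in> inner j \<or> e \<in> outer j \<or> (0 < j \<and> e \<in> outer (j - 1))" if ev: "e \<in> E" "v \<in> e" "v \<in> L j" for e v j
  proof -
    have "card e = 2" using that(1) E by (auto simp: edges_on_def)
    then obtain u where u: "e = {v, u}" using ev(2) by (auto simp: card_2_iff)
    then have "u \<in> W" "lev u \<le> Suc j" using adj[of v u] that by (auto simp: L_def)
    moreover have "j \<le> Suc (lev u)" using adj[of u v] u that \<open>u \<in> W\<close> by (auto simp: L_def insert_commute)
    ultimately consider "u \<in> L j" | "u \<in> L (Suc j)" | "0 < j" "u \<in> L (j - 1)"
      by (cases "lev u = j"; cases "lev u = Suc j") (auto simp: L_def)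
    then show ?thesis
    proof cases
      case 3
      then have "e = {u, v}" "v \<in> L (Suc (j - 1))" using u that by auto
      then show ?thesis using 3 that(1) unfolding outer_def by blast
    qed (use u that in \<open>auto simp: inner_def outer_def\<close>)
  qed
  have inner_le: "card (inner j) \<le> 2 * l * card (L j)" if "j < l" for j
  proof (rule layer_edges_bound[OF l that E free root par])
    show "inner j \<subseteq> edges_on (L j)" using E by (auto simp: inner_def edges_on_def)
    show "\<exists>u\<in>e. lev u = j" if "e \<in> inner j" for e
    proof -
      have "card e = 2" "e \<subseteq> L j" using that E by (auto simp: inner_def edges_on_def)
      then show ?thesis by (auto simp: card_2_iff L_def)
    qed
  qed (use finL in \<open>auto simp: inner_def L_def\<close>)
  have outer_le: "card (outer j) \<le> 2 * l * (card (L j) + card (L (Suc j)))" if "j < l" for j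
  proof -
    have "card (outer j) \<le> 2 * l * card (L j \<union> L (Suc j))"
    proof (rule layer_edges_bound[OF l that E free root par])
      show "outer j \<subseteq> edges_on (L j \<union> L (Suc j))" using E by (auto simp: outer_def edges_on_def)
      show "lev x' = j" if "lev x = j" "{x, y} \<in> outer j" "{y, x'} \<in> outer j" for x y x'
        using that by (auto simp: outer_def L_def doubleton_eq_iff)
    qed (use finL in \<open>auto simp: outer_def L_def\<close>)
    also have "\<dots> \<le> 2 * l * (card (L j) + card (L (Suc j)))"
      by (intro mult_left_mono card_Un_le) auto
    finally show ?thesis .
  qed
  have deg_sum: "4 * l * (q + 4) * card (L j) \<le> 2 * card {e \<in> E. e \<inter> L j \<noteq> {}}" for j
  proof -
    have "4 * l * (q + 4) * card (L j) \<le> (\<Sum>v\<in>L j. card {e \<in> E. v \<in> e})"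
    proof -
      have "4 * l * (q + 4) \<le> card {e \<in> E. v \<in> e}" if "v \<in> L j" for v
      proof -
        have "v \<in> V" using that WV by (auto simp: L_def)
        have "inj_on (\<lambda>u. {v, u}) {u \<in> V. {v, u} \<in> E}" by (auto simp: inj_on_def doubleton_eq_iff)
        then have "card {u \<in> V. {v, u} \<in> E} = card ((\<lambda>u. {v, u}) ` {u \<in> V. {v, u} \<in> E})"
          by (simp add: card_image)
        also have "\<dots> \<le> card {e \<in> E. v \<in> e}" using finE by (intro card_mono) auto
        finally show ?thesis using deg[OF \<open>v \<in> V\<close>] by linarith
      qed
      then show ?thesis using sum_mono[of "L j" "\<lambda>_. 4 * l * (q + 4)" "\<lambda>v. card {e \<in> E. v \<in> e}"]
        by (simp add: mult.commute)
    qed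
    also have "\<dots> = (\<Sum>v\<in>L j. \<Sum>e\<in>E. if v \<in> e then 1 else 0)"
      using finE by (simp add: sum.If_cases Int_def)
    also have "\<dots> = (\<Sum>e\<in>E. \<Sum>v\<in>L j. if v \<in> e then 1 else 0)" by (rule sum.swap)
    also have "\<dots> = (\<Sum>e\<in>E. card (L j \<inter> e))"
      using finL by (simp add: sum.If_cases Int_def)
    also have "\<dots> = (\<Sum>e\<in>{e \<in> E. e \<inter> L j \<noteq> {}}. card (L j \<inter> e))"
      using finE by (intro sum.mono_neutral_right) (auto simp: Int_commute)
    also have "\<dots> \<le> (\<Sum>e\<in>{e \<in> E. e \<inter> L j \<noteq> {}}. 2)"
    proof (rule sum_mono)
      fix e assume "e \<in> {e \<in> E. e \<inter> L j \<noteq> {}}"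
      then have "card e = 2" using E by (auto simp: edges_on_def)
      then show "card (L j \<inter> e) \<le> 2" by (metis Int_lower2 card.infinite card_mono zero_neq_numeral)
    qed
    finally show ?thesis by (simp add: mult.commute)
  qed
  \<comment> \<open>Edges at \<open>L j\<close> lie inside the layer or lead to a neighbouring one.
    They number at most \<open>2 * l * (4 * card (L j) + card (L (Suc j)))\<close>, and the 4 is
    what the \<open>q + 4\<close> in the degree hypothesis cancels.\<close>
  have growth: "q * card (L j) \<le> card (L (Suc j))" if "j < l" "0 < j \<Longrightarrow> card (L (j - 1)) \<le> card (L j)" for j
  proof -
    \<comment> \<open>At \<open>j = 0\<close> truncated subtraction would turn
      \<open>outer (j - 1)\<close> into \<open>outer 0\<close>, although there is no earlier
      layer.\<close>
    define prev where "prev = (if j = 0 then {} else outer (j - 1))"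
    have "{e \<in> E. e \<inter> L j \<noteq> {}} \<subseteq> inner j \<union> outer j \<union> prev"
      using edge_cases by (fastforce simp: prev_def)
    then have "card {e \<in> E. e \<inter> L j \<noteq> {}} \<le> card (inner j \<union> outer j \<union> prev)"
      using finE by (intro card_mono) (auto simp: prev_def inner_def outer_def)
    also have "\<dots> \<le> card (inner j) + card (outer j) + card prev"
      by (meson add_le_mono1 card_Un_le le_trans)
    also have "card prev \<le> 2 * l * (2 * card (L j))"
    proof (cases "j = 0")
      case False
      then have "card prev \<le> 2 * l * (card (L (j - 1)) + card (L j))"
        using outer_le[of "j - 1"] that(1) by (simp add: prev_def)
      also have "\<dots> \<le> 2 * l * (2 * card (L j))" using that(2) False by (intro mult_left_mono) auto
      finally show ?thesis .
    qed (simp add: prev_def)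
    finally have "card {e \<in> E. e \<inter> L j \<noteq> {}} \<le> 2 * l * (4 * card (L j) + card (L (Suc j)))"
      using inner_le[OF that(1)] outer_le[OF that(1)] by (simp add: algebra_simps)
    then have "4 * l * (q + 4) * card (L j) \<le> 4 * l * (4 * card (L j) + card (L (Suc j)))"
      using deg_sum[of j] by linarith
    then have "(q + 4) * card (L j) \<le> 4 * card (L j) + card (L (Suc j))"
      using l by (simp add: mult.assoc)
    then show ?thesis by (simp add: algebra_simps)
  qed
  have "j \<le> l \<Longrightarrow> q ^ j \<le> card (L j) \<and> (0 < j \<longrightarrow> card (L (j - 1)) \<le> card (L j))" for j
  proof (induction j)
    case 0
    have "r \<in> L 0" using rW by (simp add: L_def)
    then have "0 < card (L 0)" using finL card_gt_0_iff by blast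
    then show ?case by simp
  next
    case (Suc j)
    then have IH: "q ^ j \<le> card (L j)" "0 < j \<Longrightarrow> card (L (j - 1)) \<le> card (L j)" by auto
    have g: "q * card (L j) \<le> card (L (Suc j))" using growth[of j] IH(2) Suc.prems by simp
    have "q * q ^ j \<le> q * card (L j)" using IH(1) by (intro mult_left_mono) auto
    moreover have "1 * card (L j) \<le> q * card (L j)" using q by (intro mult_right_mono) auto
    ultimately have "q * q ^ j \<le> card (L (Suc j))" "card (L j) \<le> card (L (Suc j))"
      using g by linarith+
    then show ?case by simp
  qed
  then have "q ^ l \<le> card (L l)" by blast
  also have "\<dots> \<le> card V" using WV fin by (intro card_mono) (auto simp: L_def)
  finally show ?thesis .
qed

theorem bondy_simonovits:
  assumes l: "2 \<le> l" and fin: "finite V" and E: "E \<subseteq> edges_on V" and free: "cycles_in (2 * l) E = {}"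
  shows "card E \<le> 24 * real l * card V powr (1 + 1 / l)"
proof (cases "V = {}")
  case True
  then have "E = {}" using E by auto
  then show ?thesis by simp
next
  case False
  define n where "n = real (card V)"
  have n: "1 \<le> n" using False fin by (simp add: n_def Suc_leI card_gt_0_iff)
  \<comment> \<open>Floor plus one is strictly above the \<open>l\<close>-th root of
    \<open>n\<close>, so \<open>q ^ l > n\<close>. The slack
    \<open>q + 4 \<le> 6 * n powr (1 / l)\<close> gives the constant \<open>24 * l\<close>.\<close>
  define q where "q = nat \<lfloor>n powr (1 / l)\<rfloor> + 1"
  have root0: "1 \<le> n powr (1 / l)" using n by (intro ge_one_powr_ge_zero) auto
  have "real q = \<lfloor>n powr (1 / l)\<rfloor> + 1" using root0 by (simp add: q_def)
  then have q: "n powr (1 / l) < q" "q \<le> n powr (1 / l) + 1" by linarith+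
  have "card E \<le> 4 * l * (q + 4) * card V"
  proof (rule ccontr)
    assume "\<not> ?thesis"
    then obtain U where U: "U \<subseteq> V" "U \<noteq> {}" "\<forall>v\<in>U. 4 * l * (q + 4) < card {u \<in> U. {v, u} \<in> E}"
      using min_degree_subgraph[OF fin E, of "4 * l * (q + 4)"] by (auto simp: not_le)
    define E' where "E' = E \<inter> edges_on U"
    have finU: "finite U" using U fin finite_subset by blast
    have "{u \<in> U. {v, u} \<in> E} \<subseteq> {u \<in> U. {v, u} \<in> E'}" if "v \<in> U" for v
      using that E by (auto simp: E'_def edges_on_def)
    then have deg: "4 * l * (q + 4) \<le> card {u \<in> U. {v, u} \<in> E'}" if "v \<in> U" for v
      using U(3) that card_mono[of "{u \<in> U. {v, u} \<in> E'}" "{u \<in> U. {v, u} \<in> E}"] finU by fastforce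
    have "cycles_in (2 * l) E' = {}" using free cycles_in_mono[of E' E "2 * l"] by (auto simp: E'_def)
    then have "q ^ l \<le> card U"
      using min_degree_even_cycle_free[OF l _ finU U(2) _ _ deg] by (simp add: E'_def q_def)
    also have "\<dots> \<le> card V" using U(1) fin by (rule card_mono[rotated])
    finally have "real q ^ l \<le> n" unfolding n_def by (metis of_nat_le_iff of_nat_power)
    moreover have "(n powr (1 / l)) ^ l < real q ^ l"
      using q(1) l by (intro power_strict_mono) auto
    moreover have "(n powr (1 / l)) ^ l = n" using n l by (simp add: powr_power)
    ultimately show False by simp
  qed
  then have "real (card E) \<le> real (4 * l * (q + 4) * card V)" by (rule of_nat_mono)
  also have "\<dots> = 4 * l * (real q + 4) * n" by (simp add: n_def)
  also have "\<dots> \<le> 4 * l * (6 * n powr (1 / l)) * n"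
    using q root0 n by (intro mult_right_mono mult_left_mono) auto
  also have "\<dots> = 24 * l * n powr (1 + 1 / l)" using n by (simp add: powr_add)
  finally show ?thesis by (simp add: n_def)
qed

section \<open>Balanced supersaturation\<close>

text \<open>The law of a random subset that contains each element independently with probability
  \<open>p\<close>; expectations are sums over \<open>Pow V\<close>.\<close>

definition subset_prob :: "'a set \<Rightarrow> real \<Rightarrow> 'a set \<Rightarrow> real" where
  "subset_prob V p R = p ^ card R * (1 - p) ^ card (V - R)"

lemma sum_subset_prob:
  assumes "finite V"
  shows "(\<Sum>R\<in>Pow V. subset_prob V p R) = 1"
  using prod_add[OF assms, of "\<lambda>_. p" "\<lambda>_. 1 - p"]
  by (simp add: subset_prob_def)

lemma sum_subset_prob_superset:
  assumes fin: "finite V" and F: "F \<subseteq> V"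
  shows "(\<Sum>R\<in>Pow V. subset_prob V p R * (if F \<subseteq> R then 1 else 0)) = p ^ card F"
proof -
  have "(\<Sum>R\<in>Pow V. subset_prob V p R * (if F \<subseteq> R then 1 else 0)) = (\<Sum>R | R \<in> Pow V \<and> F \<subseteq> R. subset_prob V p R)"
    using fin by (subst sum.inter_filter) (auto intro: sum.cong)
  also have "\<dots> = (\<Sum>Q\<in>Pow (V - F). p ^ card F * subset_prob (V - F) p Q)"
  proof (rule sum.reindex_bij_witness[of _ "\<lambda>Q. F \<union> Q" "\<lambda>R. R - F"])
    fix R assume R: "R \<in> {R \<in> Pow V. F \<subseteq> R}"
    then have "F \<subseteq> R" "finite R" "finite F" using fin by (auto intro: finite_subset)
    then have "card R = card F + card (R - F)" using card_mono[of R F] by (simp add: card_Diff_subset)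
    moreover have "V - F - (R - F) = V - R" using R by auto
    ultimately show "p ^ card F * subset_prob (V - F) p (R - F) = subset_prob V p R"
      by (simp add: subset_prob_def power_add)
  qed (use F in auto)
  also have "\<dots> = p ^ card F"
    using fin by (simp add: sum_distrib_left[symmetric] sum_subset_prob)
  finally show ?thesis .
qed

text \<open>Linearity of expectation. It is applied to edges, to saturated sets \<open>T\<close>
  with \<open>F T = \<Union>T\<close>, and to ordered pairs of vertices.\<close>

lemma sum_subset_prob_count:
  assumes fin: "finite V" "finite I" and F: "\<And>i. i \<in> I \<Longrightarrow> F i \<subseteq> V"
  shows "(\<Sum>R\<in>Pow V. subset_prob V p R * card {i \<in> I. F i \<subseteq> R}) = (\<Sum>i\<in>I. p ^ card (F i))"
proof -
  have "(\<Sum>R\<in>Pow V. subset_prob V p R * card {i \<in> I. F i \<subseteq> R})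
      = (\<Sum>R\<in>Pow V. \<Sum>i\<in>I. subset_prob V p R * (if F i \<subseteq> R then 1 else 0))"
  proof (rule sum.cong[OF refl])
    fix R
    have "real (card {i \<in> I. F i \<subseteq> R}) = (\<Sum>i\<in>I. if F i \<subseteq> R then 1 else 0)"
      using fin(2) by (simp add: sum.If_cases Int_def)
    then show "subset_prob V p R * card {i \<in> I. F i \<subseteq> R} = (\<Sum>i\<in>I. subset_prob V p R * (if F i \<subseteq> R then 1 else 0))"
      by (simp only: sum_distrib_left)
  qed
  also have "\<dots> = (\<Sum>i\<in>I. \<Sum>R\<in>Pow V. subset_prob V p R * (if F i \<subseteq> R then 1 else 0))"
    by (rule sum.swap)
  also have "\<dots> = (\<Sum>i\<in>I. p ^ card (F i))"
    using F by (intro sum.cong refl sum_subset_prob_superset fin) auto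
  finally show ?thesis .
qed

text \<open>Replaces the fractional power in the extremal bound by a square, so that the second
  moment of \<open>card R\<close> suffices.\<close>

lemma powr_le_square_bound:
  fixes x t \<alpha> :: real
  assumes "0 \<le> x" "0 < t" "0 \<le> \<alpha>" "\<alpha> \<le> 2"
  shows "x powr \<alpha> \<le> t powr \<alpha> * (1 + x\<^sup>2 / t\<^sup>2)"
proof (cases "x \<le> t")
  case True
  then have "x powr \<alpha> \<le> t powr \<alpha> * 1" using assms by (simp add: powr_mono2)
  also have "\<dots> \<le> t powr \<alpha> * (1 + x\<^sup>2 / t\<^sup>2)" by (intro mult_left_mono) auto
  finally show ?thesis .
next
  case False
  then have "x powr \<alpha> = t powr \<alpha> * (x / t) powr \<alpha>"
    using assms by (simp add: powr_divide)
  also have "(x / t) powr \<alpha> \<le> (x / t) powr 2" using False assms by (intro powr_mono) auto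
  also have "(x / t) powr 2 = x\<^sup>2 / t\<^sup>2" using False assms by (simp add: powr_numeral power_divide)
  also have "t powr \<alpha> * (x\<^sup>2 / t\<^sup>2) \<le> t powr \<alpha> * (1 + x\<^sup>2 / t\<^sup>2)" by (intro mult_left_mono) auto
  finally show ?thesis using assms by (simp add: mult_left_mono)
qed

text \<open>The square counts ordered pairs in \<open>R\<close>; the diagonal pairs account for the
  linear term.\<close>

lemma sum_subset_prob_card_square:
  assumes fin: "finite V" and p: "0 \<le> p"
  shows "(\<Sum>R\<in>Pow V. subset_prob V p R * (real (card R))\<^sup>2) \<le> (p * card V)\<^sup>2 + p * card V"
proof -
  let ?F = "\<lambda>(u, v). {u, v}"
  have "(real (card R))\<^sup>2 = real (card {x \<in> V \<times> V. ?F x \<subseteq> R})" if "R \<in> Pow V" for R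
  proof -
    have "{x \<in> V \<times> V. ?F x \<subseteq> R} = R \<times> R" using that by auto
    then show ?thesis by (simp add: power2_eq_square card_cartesian_product)
  qed
  then have "(\<Sum>R\<in>Pow V. subset_prob V p R * (real (card R))\<^sup>2)
     = (\<Sum>R\<in>Pow V. subset_prob V p R * card {x \<in> V \<times> V. ?F x \<subseteq> R})"
    by (intro sum.cong) auto
  also have "\<dots> = (\<Sum>x\<in>V \<times> V. p ^ card (?F x))"
    using fin by (intro sum_subset_prob_count) auto
  also have "\<dots> = (\<Sum>u\<in>V. \<Sum>v\<in>V. p ^ card {u, v})"
    by (simp add: sum.cartesian_product case_prod_unfold)
  also have "\<dots> \<le> (\<Sum>u\<in>V. \<Sum>v\<in>V. p\<^sup>2 + (if v = u then p else 0))"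
    using p by (intro sum_mono) (auto simp: card_insert_if power2_eq_square)
  also have "\<dots> = (p * card V)\<^sup>2 + p * card V"
    using fin by (simp add: sum.distrib power2_eq_square algebra_simps)
  finally show ?thesis .
qed

section \<open>Cycle families with bounded degrees\<close>

lemma sum_degree_le:
  fixes f :: "'b set \<Rightarrow> real"
  assumes "finite H" "\<And>C. C \<in> H \<Longrightarrow> finite C \<and> card C = k" "finite \<S>"
  shows "(\<Sum>T\<in>\<S>. real (card {C \<in> H. T \<subseteq> C})) \<le> 2 ^ k * real (card H)"
proof -
  have "(\<Sum>T\<in>\<S>. real (card {C \<in> H. T \<subseteq> C})) = (\<Sum>T\<in>\<S>. \<Sum>C\<in>H. if T \<subseteq> C then 1 else 0)"
    using assms(1) by (simp add: sum.If_cases Int_def)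
  also have "\<dots> = (\<Sum>C\<in>H. \<Sum>T\<in>\<S>. if T \<subseteq> C then 1 else 0)" by (rule sum.swap)
  also have "\<dots> = (\<Sum>C\<in>H. real (card {T \<in> \<S>. T \<subseteq> C}))"
    using assms(3) by (simp add: sum.If_cases Int_def)
  also have "\<dots> \<le> (\<Sum>C\<in>H. 2 ^ k)"
  proof (rule sum_mono)
    fix C assume "C \<in> H"
    then have "finite C" "card C = k" using assms(2) by auto
    then have "card {T \<in> \<S>. T \<subseteq> C} \<le> 2 ^ k"
      using card_mono[of "Pow C" "{T \<in> \<S>. T \<subseteq> C}"] by (auto simp: card_Pow)
    then show "real (card {T \<in> \<S>. T \<subseteq> C}) \<le> 2 ^ k"
      by (metis of_nat_le_iff of_nat_numeral of_nat_power)
  qed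
  finally show ?thesis by (simp add: mult.commute)
qed

text \<open>Take a random vertex set \<open>R\<close> with density \<open>p\<close> and delete one edge from every saturated set of edges
  inside \<open>R\<close>. In expectation more than \<open>A * card R powr \<alpha>\<close> edges survive, so they contain a cycle, and this
  cycle contains no saturated set. The truncated subtraction in the exponents is harmless: a set with more
  than \<open>2 * l\<close> edges has degree \<open>0\<close>.\<close>

lemma extend_balanced_family:
  fixes A \<alpha> p \<tau> :: real and l :: nat
  assumes l: "2 \<le> l" and fin: "finite V" and E: "E \<subseteq> edges_on V"
    and ex: "\<And>U E'. U \<subseteq> V \<Longrightarrow> E' \<subseteq> edges_on U \<Longrightarrow> cycles_in (2 * l) E' = {} \<Longrightarrow> card E' \<le> A * card U powr \<alpha>"
    and A: "0 \<le> A" and \<alpha>: "0 \<le> \<alpha>" "\<alpha> \<le> 2" and p: "0 < p" "p \<le> \<tau>" "\<tau> \<le> 1"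
    and p\<tau>: "p ^ (2 * l - 2) \<le> \<tau> ^ (2 * l - 1)" and pV: "1 \<le> p * card V"
    and dense: "12 * A * (p * card V) powr \<alpha> \<le> p\<^sup>2 * card E"
    and H: "H \<subseteq> cycles_in (2 * l) E" and small: "card H < card E * (1 / \<tau>) ^ (2 * l - 1) / 2 ^ (2 * l + 2)"
  obtains C where "C \<in> cycles_in (2 * l) E" "C \<notin> H"
    "\<And>T. T \<subseteq> C \<Longrightarrow> T \<noteq> {} \<Longrightarrow> card {C \<in> H. T \<subseteq> C} < (1 / \<tau>) ^ (2 * l - card T)"
proof -
  define k where "k = 2 * l"
  define deg where "deg = (\<lambda>T. card {C \<in> H. T \<subseteq> C})"
  define Sat where "Sat = {T. T \<subseteq> E \<and> T \<noteq> {} \<and> (1 / \<tau>) ^ (k - card T) \<le> deg T}"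
  have k: "3 \<le> k" "4 \<le> k" using l by (auto simp: k_def)
  have \<tau>0: "0 < \<tau>" using p by linarith
  have finE: "finite E" using finite_subset[OF E finite_edges_on[OF fin]] .
  have finSat: "finite Sat" using finE by (simp add: Sat_def)
  have finH: "finite H" using finite_subset[OF H finite_cycles_in[OF finE]] .
  have Hk: "finite C \<and> card C = k" if "C \<in> H" for C
    using that H cycles_in_card[OF k(1), of C E] finE by (auto simp: k_def cycles_in_def)
  have E_card: "card e = 2" "e \<subseteq> V" if "e \<in> E" for e using that E by (auto simp: edges_on_def)
  have Sat_V: "\<Union>T \<subseteq> V" if "T \<in> Sat" for T using that E_card(2) by (auto simp: Sat_def)
  let ?P = "subset_prob V p"
  \<comment> \<open>A lower bound for the surplus over the extremal bound once each saturated set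
    inside \<open>R\<close> has cost one edge.\<close>
  define X where "X = (\<lambda>R. real (card {e \<in> E. e \<subseteq> R}) - real (card {T \<in> Sat. \<Union>T \<subseteq> R})
      - A * (p * card V) powr \<alpha> * (1 + (real (card R))\<^sup>2 / (p * card V)\<^sup>2))"
  have sat_term: "p ^ card (\<Union>T) \<le> p\<^sup>2 * \<tau> ^ (k - 1) * deg T" if "T \<in> Sat" for T
  proof -
    have T: "T \<noteq> {}" "(1 / \<tau>) ^ (k - card T) \<le> deg T" using that by (auto simp: Sat_def)
    have "0 < (1 / \<tau>) ^ (k - card T)" using \<tau>0 by simp
    then have "0 < deg T" using T(2) by linarith
    then obtain C where C: "C \<in> H" "T \<subseteq> C" unfolding deg_def by (auto simp: card_gt_0_iff)
    then have CE: "C \<in> cycles_in k E" using H by (auto simp: k_def)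
    have Tk: "0 < card T" "card T \<le> k"
      using C Hk[OF C(1)] T(1) by (auto simp: card_gt_0_iff card_mono intro: finite_subset)
    have min: "min (Suc (card T)) k \<le> card (\<Union>T)" by (rule card_Union_cycle_subset[OF k(1) CE C(2) T(1)])
    \<comment> \<open>A proper part of a cycle spans one vertex more than it has edges. The full
      cycle lacks this vertex, and \<open>p\<tau>\<close> compensates for it.\<close>
    have "p ^ card (\<Union>T) \<le> p\<^sup>2 * \<tau> ^ (card T - 1)"
    proof (cases "card T = k")
      case True
      have "p ^ card (\<Union>T) \<le> p ^ (2 + (k - 2))" using min True p k by (intro power_decreasing) auto
      also have "\<dots> = p\<^sup>2 * p ^ (k - 2)" by (rule power_add)
      also have "\<dots> \<le> p\<^sup>2 * \<tau> ^ (k - 1)" using p\<tau> by (intro mult_left_mono) (auto simp: k_def)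
      finally show ?thesis using True by simp
    next
      case False
      have "p ^ card (\<Union>T) \<le> p ^ (2 + (card T - 1))" using min False Tk p by (intro power_decreasing) auto
      also have "\<dots> = p\<^sup>2 * p ^ (card T - 1)" by (rule power_add)
      also have "\<dots> \<le> p\<^sup>2 * \<tau> ^ (card T - 1)" using p by (intro mult_left_mono power_mono) auto
      finally show ?thesis .
    qed
    also have "\<tau> ^ (card T - 1) = \<tau> ^ (k - 1) * (1 / \<tau>) ^ (k - card T)"
    proof -
      have "\<tau> ^ (k - 1) = \<tau> ^ (card T - 1) * \<tau> ^ (k - card T)"
        using Tk by (simp flip: power_add)
      then show ?thesis using \<tau>0 by (simp add: power_divide)
    qed
    also have "p\<^sup>2 * (\<tau> ^ (k - 1) * (1 / \<tau>) ^ (k - card T)) \<le> p\<^sup>2 * (\<tau> ^ (k - 1) * deg T)"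
      using T(2) \<tau>0 by (intro mult_left_mono) auto
    finally show ?thesis by (simp add: mult.assoc)
  qed
  have "(\<Sum>T\<in>Sat. p ^ card (\<Union>T)) \<le> (\<Sum>T\<in>Sat. p\<^sup>2 * \<tau> ^ (k - 1) * deg T)"
    by (intro sum_mono sat_term)
  also have "\<dots> = p\<^sup>2 * \<tau> ^ (k - 1) * (\<Sum>T\<in>Sat. deg T)" by (simp add: sum_distrib_left)
  also have "\<dots> \<le> p\<^sup>2 * \<tau> ^ (k - 1) * (2 ^ k * card H)"
    using sum_degree_le[OF finH Hk finSat] \<tau>0 unfolding deg_def by (intro mult_left_mono) auto
  \<comment> \<open>The constant \<open>2 ^ (2 * l + 2)\<close> in \<open>small\<close> comes from
    here: \<open>2 ^ k\<close> subsets per cycle and a spare factor 4.\<close>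
  also have "\<dots> < p\<^sup>2 * \<tau> ^ (k - 1) * (2 ^ k * (card E * (1 / \<tau>) ^ (k - 1) / 2 ^ (k + 2)))"
  proof -
    have "real (card H) < card E * (1 / \<tau>) ^ (k - 1) / 2 ^ (k + 2)" using small unfolding k_def .
    then have "2 ^ k * real (card H) < 2 ^ k * (card E * (1 / \<tau>) ^ (k - 1) / 2 ^ (k + 2))"
      by (rule mult_strict_left_mono) simp
    moreover have "0 < p\<^sup>2 * \<tau> ^ (k - 1)" using \<tau>0 p by simp
    ultimately show ?thesis by (simp only: mult_strict_left_mono of_nat_mult of_nat_power of_nat_numeral)
  qed
  also have "\<dots> = p\<^sup>2 * card E / 4" using \<tau>0 by (simp add: power_add power_divide)
  finally have sat_sum: "(\<Sum>T\<in>Sat. p ^ card (\<Union>T)) < p\<^sup>2 * card E / 4" .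
  have sq: "(\<Sum>R\<in>Pow V. ?P R * (real (card R))\<^sup>2) / (p * card V)\<^sup>2 \<le> 2"
  proof -
    have "(\<Sum>R\<in>Pow V. ?P R * (real (card R))\<^sup>2) \<le> (p * card V)\<^sup>2 + p * card V"
      using fin p by (intro sum_subset_prob_card_square) auto
    also have "\<dots> \<le> 2 * (p * card V)\<^sup>2" using self_le_power[OF pV, of 2] by simp
    finally show ?thesis using pV by (simp add: divide_le_eq)
  qed
  have "?P R * X R = ?P R * card {e \<in> E. e \<subseteq> R} - ?P R * card {T \<in> Sat. \<Union>T \<subseteq> R}
     - (A * (p * card V) powr \<alpha> * ?P R
        + A * (p * card V) powr \<alpha> / (p * card V)\<^sup>2 * (?P R * (real (card R))\<^sup>2))" for R
    by (simp add: X_def field_simps)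
  then have "(\<Sum>R\<in>Pow V. ?P R * X R) = (\<Sum>R\<in>Pow V. ?P R * card {e \<in> E. e \<subseteq> R})
     - (\<Sum>R\<in>Pow V. ?P R * card {T \<in> Sat. \<Union>T \<subseteq> R})
     - A * (p * card V) powr \<alpha> * ((\<Sum>R\<in>Pow V. ?P R) + (\<Sum>R\<in>Pow V. ?P R * (real (card R))\<^sup>2) / (p * card V)\<^sup>2)"
    by (simp only: sum.distrib sum_subtractf sum_distrib_left[symmetric]) (simp add: algebra_simps)
  also have "(\<Sum>R\<in>Pow V. ?P R * card {e \<in> E. e \<subseteq> R}) = (\<Sum>e\<in>E. p ^ card e)"
    by (intro sum_subset_prob_count fin finE E_card)
  also have "\<dots> = p\<^sup>2 * card E" using E_card by simp
  also have "(\<Sum>R\<in>Pow V. ?P R * card {T \<in> Sat. \<Union>T \<subseteq> R}) = (\<Sum>T\<in>Sat. p ^ card (\<Union>T))"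
    by (intro sum_subset_prob_count fin finSat Sat_V)
  also have "(\<Sum>R\<in>Pow V. ?P R) = 1" by (rule sum_subset_prob[OF fin])
  finally have EX: "(\<Sum>R\<in>Pow V. ?P R * X R) = p\<^sup>2 * card E - (\<Sum>T\<in>Sat. p ^ card (\<Union>T))
     - A * (p * card V) powr \<alpha> * (1 + (\<Sum>R\<in>Pow V. ?P R * (real (card R))\<^sup>2) / (p * card V)\<^sup>2)" .
  \<comment> \<open>The second moment is at most twice \<open>(p * card V)\<^sup>2\<close>, so the
    factor is at most 3. The 12 in \<open>dense\<close> makes this loss a quarter of the expected
    number of edges.\<close>
  have "A * (p * card V) powr \<alpha> * (1 + (\<Sum>R\<in>Pow V. ?P R * (real (card R))\<^sup>2) / (p * card V)\<^sup>2)
     \<le> A * (p * card V) powr \<alpha> * 3"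
    using sq A by (intro mult_left_mono) auto
  also have "\<dots> \<le> p\<^sup>2 * card E / 4" using dense by simp
  finally have tail: "A * (p * card V) powr \<alpha> * (1 + (\<Sum>R\<in>Pow V. ?P R * (real (card R))\<^sup>2) / (p * card V)\<^sup>2)
     \<le> p\<^sup>2 * card E / 4" .
  have "0 \<le> p\<^sup>2 * card E" by simp
  with tail sat_sum have pos: "0 < (\<Sum>R\<in>Pow V. ?P R * X R)" unfolding EX by linarith
  have "\<exists>R\<in>Pow V. 0 < X R"
  proof (rule ccontr)
    assume "\<not> ?thesis"
    then have "(\<Sum>R\<in>Pow V. ?P R * X R) \<le> 0"
      using p by (intro sum_nonpos mult_nonneg_nonpos) (auto simp: subset_prob_def not_less)
    with pos show False by simp
  qed
  then obtain R where R: "R \<in> Pow V" "0 < X R" by blast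
  define E' where "E' = {e \<in> E. e \<subseteq> R} - (\<lambda>T. SOME e. e \<in> T) ` {T \<in> Sat. \<Union>T \<subseteq> R}"
  have "A * card R powr \<alpha> \<le> A * ((p * card V) powr \<alpha> * (1 + (real (card R))\<^sup>2 / (p * card V)\<^sup>2))"
    using A \<alpha> pV by (intro mult_left_mono powr_le_square_bound) auto
  also have "\<dots> < real (card {e \<in> E. e \<subseteq> R}) - real (card {T \<in> Sat. \<Union>T \<subseteq> R})"
    using R(2) by (simp add: X_def)
  also have "\<dots> \<le> card E'"
  proof -
    have "card {e \<in> E. e \<subseteq> R} - card ((\<lambda>T. SOME e. e \<in> T) ` {T \<in> Sat. \<Union>T \<subseteq> R}) \<le> card E'"
      unfolding E'_def using finSat by (intro diff_card_le_card_Diff) auto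
    moreover have "card ((\<lambda>T. SOME e. e \<in> T) ` {T \<in> Sat. \<Union>T \<subseteq> R}) \<le> card {T \<in> Sat. \<Union>T \<subseteq> R}"
      using finSat by (intro card_image_le) auto
    ultimately show ?thesis by linarith
  qed
  finally have "\<not> card E' \<le> A * card R powr \<alpha>" by simp
  moreover have "E' \<subseteq> edges_on R" using E_card by (auto simp: E'_def edges_on_def)
  ultimately obtain C where C: "C \<in> cycles_in k E'" using ex[of R E'] R(1) by (auto simp: k_def)
  have CE: "C \<in> cycles_in k E" using C cycles_in_mono[of E' E k] by (auto simp: E'_def)
  have CE': "C \<subseteq> E'" using C by (auto simp: cycles_in_def)
  have notSat: "T \<notin> Sat" if "T \<subseteq> C" for T
  proof
    assume "T \<in> Sat"
    moreover have "\<Union>T \<subseteq> R" using that CE' by (auto simp: E'_def)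
    ultimately have "(SOME e. e \<in> T) \<notin> E'" by (auto simp: E'_def)
    moreover have "(SOME e. e \<in> T) \<in> T" using \<open>T \<in> Sat\<close> by (simp add: Sat_def some_in_eq)
    ultimately show False using that CE' by blast
  qed
  have CsubE: "C \<subseteq> E" using CE by (auto simp: cycles_in_def)
  have low: "card {C \<in> H. T \<subseteq> C} < (1 / \<tau>) ^ (2 * l - card T)" if "T \<subseteq> C" "T \<noteq> {}" for T
    using notSat[OF that(1)] that CsubE by (auto simp: Sat_def deg_def k_def not_le)
  \<comment> \<open>For \<open>T = C\<close> the exponent in \<open>low\<close> is 0, so fewer than
    one member of \<open>H\<close> contains \<open>C\<close>.\<close>
  moreover have "C \<notin> H"
  proof
    assume "C \<in> H"
    then have "card {D \<in> H. C \<subseteq> D} > 0" using finH by (auto simp: card_gt_0_iff)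
    moreover have "C \<noteq> {}" "card C = k" using cycles_in_card[OF k(1) CE] k by auto
    ultimately show False using low[of C] by (simp add: k_def)
  qed
  ultimately show thesis using that CE by (auto simp: k_def)
qed

text \<open>In a family of maximal size the extension must fail. A new cycle raises only degrees
  below \<open>(1 / \<tau>) ^ (2 * l - card T)\<close>, and by one, which is at most that power
  again: hence the factor 2.\<close>

lemma balanced_supersaturation:
  fixes A \<alpha> p \<tau> :: real and l :: nat
  assumes l: "2 \<le> l" and fin: "finite V" and E: "E \<subseteq> edges_on V"
    and ex: "\<And>U E'. U \<subseteq> V \<Longrightarrow> E' \<subseteq> edges_on U \<Longrightarrow> cycles_in (2 * l) E' = {} \<Longrightarrow> card E' \<le> A * card U powr \<alpha>"
    and A: "0 \<le> A" and \<alpha>: "0 \<le> \<alpha>" "\<alpha> \<le> 2" and p: "0 < p" "p \<le> \<tau>" "\<tau> \<le> 1"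
    and p\<tau>: "p ^ (2 * l - 2) \<le> \<tau> ^ (2 * l - 1)" and pV: "1 \<le> p * card V"
    and dense: "12 * A * (p * card V) powr \<alpha> \<le> p\<^sup>2 * card E"
  obtains H where "H \<subseteq> cycles_in (2 * l) E"
    "\<And>T. T \<noteq> {} \<Longrightarrow> card {C \<in> H. T \<subseteq> C} \<le> 2 * (1 / \<tau>) ^ (2 * l - card T)"
    "card E * (1 / \<tau>) ^ (2 * l - 1) / 2 ^ (2 * l + 2) \<le> card H"
proof -
  define good where "good = (\<lambda>H. H \<subseteq> cycles_in (2 * l) E \<and>
    (\<forall>T. T \<noteq> {} \<longrightarrow> card {C \<in> H. T \<subseteq> C} \<le> 2 * (1 / \<tau>) ^ (2 * l - card T)))"
  have finE: "finite E" using finite_subset[OF E finite_edges_on[OF fin]] .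
  have finC: "finite (cycles_in (2 * l) E)" using finE by (rule finite_cycles_in)
  have inv: "1 \<le> 1 / \<tau>" using p by simp
  have "{H. good H} \<subseteq> Pow (cycles_in (2 * l) E)" unfolding good_def by blast
  then have fin_good: "finite (card ` {H. good H})" using finC finite_subset by blast
  have "good {}" using p by (simp add: good_def)
  then have "card ` {H. good H} \<noteq> {}" by blast
  from Max_in[OF fin_good this] obtain H where H: "good H" and "Max (card ` {H. good H}) = card H"
    by blast
  then have max: "card H' \<le> card H" if "good H'" for H'
    using Max_ge[OF fin_good, of "card H'"] that by simp
  have finH: "finite H" using H finite_subset[OF _ finC] unfolding good_def by blast
  have "card E * (1 / \<tau>) ^ (2 * l - 1) / 2 ^ (2 * l + 2) \<le> card H"
  proof (rule ccontr)
    assume "\<not> ?thesis"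
    then have small: "card H < card E * (1 / \<tau>) ^ (2 * l - 1) / 2 ^ (2 * l + 2)" by simp
    have "H \<subseteq> cycles_in (2 * l) E" using H by (simp add: good_def)
    from extend_balanced_family[OF l fin E ex A \<alpha> p p\<tau> pV dense this small]
    obtain C where C: "C \<in> cycles_in (2 * l) E" "C \<notin> H"
      "\<And>T. T \<subseteq> C \<Longrightarrow> T \<noteq> {} \<Longrightarrow> card {C \<in> H. T \<subseteq> C} < (1 / \<tau>) ^ (2 * l - card T)" by blast
    have "good (insert C H)" unfolding good_def
    proof (intro conjI allI impI)
      show "insert C H \<subseteq> cycles_in (2 * l) E" using C(1) H by (auto simp: good_def)
      fix T :: "'a set set" assume "T \<noteq> {}"
      show "card {D \<in> insert C H. T \<subseteq> D} \<le> 2 * (1 / \<tau>) ^ (2 * l - card T)"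
      proof (cases "T \<subseteq> C")
        case True
        then have "{D \<in> insert C H. T \<subseteq> D} = insert C {D \<in> H. T \<subseteq> D}" by auto
        then have "card {D \<in> insert C H. T \<subseteq> D} = Suc (card {D \<in> H. T \<subseteq> D})" using C(2) finH by simp
        moreover have "1 \<le> (1 / \<tau>) ^ (2 * l - card T)" using inv by (rule one_le_power)
        ultimately show ?thesis using C(3)[OF True \<open>T \<noteq> {}\<close>] by simp
      next
        case False
        then have "{D \<in> insert C H. T \<subseteq> D} = {D \<in> H. T \<subseteq> D}" by auto
        then show ?thesis using H \<open>T \<noteq> {}\<close> by (simp add: good_def)
      qed
    qed
    from max[OF this] C(2) finH show False by simp
  qed
  then show thesis using that H by (auto simp: good_def)
qed

section \<open>Containers for even-cycle-free graphs\<close>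

text \<open>With \<open>x\<close> the number of edges divided by \<open>f\<close>, one step costs \<open>a * x powr - \<eta> * f\<close> in the exponent. This
  is the decrease of the potential \<open>- D * f * x powr - \<eta>\<close> when \<open>x\<close> shrinks by the factor \<open>1 - c\<close>, so the
  total cost telescopes.\<close>

lemma container_iteration:
  fixes f c a \<eta> D K :: real
  assumes f: "0 < f" and c: "0 < c" "c < 1" and \<eta>: "0 < \<eta>" and D: "0 \<le> D" "D * ((1 - c) powr - \<eta> - 1) = a"
    and K: "0 < K"
    and step: "\<And>E. E \<subseteq> E0 \<Longrightarrow> K * f \<le> card E \<Longrightarrow>
      \<exists>\<C>. finite \<C> \<and> real (card \<C>) \<le> exp (a * (card E / f) powr - \<eta> * f) \<and>
        (\<forall>C\<in>\<C>. C \<subseteq> E \<and> card C \<le> (1 - c) * card E) \<and> (\<forall>I\<subseteq>E. P I \<longrightarrow> (\<exists>C\<in>\<C>. I \<subseteq> C))"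
  shows "E \<subseteq> E0 \<Longrightarrow> real (card E) \<le> M \<Longrightarrow> (1 - c) * K * f \<le> M \<Longrightarrow>
    \<exists>\<F>. finite \<F> \<and> real (card \<F>) \<le> exp (D * f * (((1 - c) * K) powr - \<eta> - (M / f) powr - \<eta>)) \<and>
      (\<forall>F\<in>\<F>. F \<subseteq> E0 \<and> card F \<le> K * f) \<and> (\<forall>I\<subseteq>E. P I \<longrightarrow> (\<exists>F\<in>\<F>. I \<subseteq> F))"
proof (induction "card E" arbitrary: E M rule: less_induct)
  case less
  note E = less.prems(1) and ME = less.prems(2) and MK = less.prems(3)
  define \<kappa> where "\<kappa> = ((1 - c) * K) powr - \<eta>"
  show ?case
  proof (cases "card E \<le> K * f")
    case True
    \<comment> \<open>A step from just above \<open>K * f\<close> can bring \<open>M\<close> down to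
      about \<open>(1 - c) * K * f\<close>, so the potential is measured from
      \<open>(1 - c) * K\<close>.\<close>
    have "(1 - c) * K \<le> M / f" using MK f by (simp add: field_simps)
    then have "(M / f) powr - \<eta> \<le> \<kappa>" unfolding \<kappa>_def using c K \<eta> by (intro powr_mono2') auto
    then have "0 \<le> D * f * (\<kappa> - (M / f) powr - \<eta>)" using D f by simp
    then show ?thesis using E True unfolding \<kappa>_def[symmetric] by (intro exI[of _ "{E}"]) auto
  next
    case False
    then have big: "K * f < card E" by simp
    have pos: "0 < real (card E)" using big K f by (smt (verit) mult_pos_pos)
    obtain \<C> where C0: "finite \<C>" "real (card \<C>) \<le> exp (a * (card E / f) powr - \<eta> * f)"
      "\<forall>C\<in>\<C>. C \<subseteq> E \<and> card C \<le> (1 - c) * card E" "\<forall>I\<subseteq>E. P I \<longrightarrow> (\<exists>C\<in>\<C>. I \<subseteq> C)"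
      using step[OF E less_imp_le[OF big]] by (elim exE conjE) (rule that)
    note C = C0(1,2) C0(3)[rule_format] C0(4)[rule_format]
    define M' where "M' = (1 - c) * card E"
    define \<nu> where "\<nu> = D * f * (\<kappa> - (M' / f) powr - \<eta>)"
    have "\<exists>\<F>. finite \<F> \<and> real (card \<F>) \<le> exp \<nu> \<and>
      (\<forall>F\<in>\<F>. F \<subseteq> E0 \<and> card F \<le> K * f) \<and> (\<forall>I\<subseteq>C. P I \<longrightarrow> (\<exists>F\<in>\<F>. I \<subseteq> F))" if "C \<in> \<C>" for C
      unfolding \<nu>_def \<kappa>_def
    proof (rule less.hyps)
      have "(1 - c) * card E < card E" using c pos by (simp add: algebra_simps)
      then show "card C < card E" using C(3)[OF that] by linarith
      show "C \<subseteq> E0" using C(3)[OF that] E by blast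
      show "card C \<le> M'" using C(3)[OF that] by (simp add: M'_def)
      have "(1 - c) * (K * f) \<le> (1 - c) * card E" using big c by (intro mult_left_mono) auto
      then show "(1 - c) * K * f \<le> M'" by (simp add: M'_def)
    qed
    then obtain \<F> where F: "\<And>C. C \<in> \<C> \<Longrightarrow> finite (\<F> C)" "\<And>C. C \<in> \<C> \<Longrightarrow> real (card (\<F> C)) \<le> exp \<nu>"
      "\<And>C F. C \<in> \<C> \<Longrightarrow> F \<in> \<F> C \<Longrightarrow> F \<subseteq> E0 \<and> card F \<le> K * f"
      "\<And>C I. C \<in> \<C> \<Longrightarrow> I \<subseteq> C \<Longrightarrow> P I \<Longrightarrow> \<exists>F\<in>\<F> C. I \<subseteq> F"
      by metis
    have "real (card (\<Union>C\<in>\<C>. \<F> C)) \<le> (\<Sum>C\<in>\<C>. real (card (\<F> C)))"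
      using card_UN_le[OF C(1), of \<F>] by (metis of_nat_mono of_nat_sum)
    also have "\<dots> \<le> (\<Sum>C\<in>\<C>. exp \<nu>)" using F(2) by (intro sum_mono)
    also have "\<dots> = card \<C> * exp \<nu>" by simp
    also have "\<dots> \<le> exp (a * (card E / f) powr - \<eta> * f) * exp \<nu>" using C(2) by (intro mult_right_mono) auto
    also have "\<dots> = exp (D * f * (\<kappa> - (card E / f) powr - \<eta>))"
    proof -
      have "M' / f = (1 - c) * (card E / f)" by (simp add: M'_def)
      then have "(M' / f) powr - \<eta> = (1 - c) powr - \<eta> * (card E / f) powr - \<eta>"
        using c f by (simp only: powr_mult)
      then show ?thesis by (simp add: \<nu>_def D(2)[symmetric] algebra_simps flip: exp_add)
    qed
    also have "\<dots> \<le> exp (D * f * (\<kappa> - (M / f) powr - \<eta>))"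
    proof -
      have "(M / f) powr - \<eta> \<le> (card E / f) powr - \<eta>"
        using ME pos f \<eta> by (intro powr_mono2' divide_right_mono) auto
      then show ?thesis using D(1) f by (simp add: mult_left_mono)
    qed
    finally have "real (card (\<Union>C\<in>\<C>. \<F> C)) \<le> exp (D * f * (\<kappa> - (M / f) powr - \<eta>))" .
    then show ?thesis unfolding \<kappa>_def[symmetric]
    proof (intro exI[of _ "\<Union>C\<in>\<C>. \<F> C"] conjI ballI allI impI)
      show "finite (\<Union>C\<in>\<C>. \<F> C)" using C(1) F(1) by blast
      show "\<exists>F\<in>(\<Union>C\<in>\<C>. \<F> C). I \<subseteq> F" if I: "I \<subseteq> E" "P I" for I
      proof -
        obtain C where "C \<in> \<C>" "I \<subseteq> C" using C(4)[OF I] by blast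
        then show ?thesis using F(4)[of C I] I(2) by blast
      qed
    qed (use F(3) in blast)+
  qed
qed

section \<open>One container step for even cycles\<close>

lemma card_edges_on_le:
  assumes "finite V" "E \<subseteq> edges_on V"
  shows "real (card E) \<le> (real (card V))\<^sup>2"
proof -
  have "card E \<le> card (edges_on V)" using assms finite_edges_on by (intro card_mono) auto
  also have "\<dots> = card V choose 2" using assms(1) by (simp add: edges_on_def n_subsets)
  also have "\<dots> \<le> (card V)\<^sup>2" by (simp add: choose_two power2_eq_square div_le_mono le_trans[OF div_le_dividend])
  finally show ?thesis by (metis of_nat_le_iff of_nat_power)
qed

lemma cycles_in_restrict: "C \<in> cycles_in k E \<Longrightarrow> C \<subseteq> I \<Longrightarrow> C \<in> cycles_in k I"
  by (simp add: cycles_in_def)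

text \<open>The weight per cycle cancels the degree bound down to
  \<open>\<tau> ^ (card T - 1)\<close>. The total that remains dictates the value
  \<open>1 / 2 ^ (2 * l + 3)\<close> of \<beta> in the container theorem.\<close>

lemma balanced_weight:
  fixes \<tau> :: real
  assumes l: "2 \<le> l" and \<tau>: "0 < \<tau>" and finE: "finite E" and H: "H \<subseteq> cycles_in (2 * l) E"
    and deg: "\<And>T. T \<noteq> {} \<Longrightarrow> card {C \<in> H. T \<subseteq> C} \<le> 2 * (1 / \<tau>) ^ (2 * l - card T)"
    and large: "card E * (1 / \<tau>) ^ (2 * l - 1) / 2 ^ (2 * l + 2) \<le> card H"
    and w_def: "w = (\<lambda>C. if C \<in> H then \<tau> ^ (2 * l - 1) / 2 else 0)"
  shows "weight_on E (2 * l) w" "\<And>T. T \<noteq> {} \<Longrightarrow> wdeg E w T \<le> \<tau> ^ (card T - 1)"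
    "1 / 2 ^ (2 * l + 3) * card E \<le> wdeg E w {}" "\<And>I. I \<subseteq> E \<Longrightarrow> cycles_in (2 * l) I = {} \<Longrightarrow> independent_set w I"
proof -
  have HE: "C \<subseteq> E" "card C = 2 * l" if "C \<in> H" for C
    using that H cycles_in_card[of "2 * l" C E] l by (auto simp: cycles_in_def)
  show "weight_on E (2 * l) w" using HE \<tau> by (auto simp: weight_on_def w_def)
  have wdeg: "wdeg E w T = \<tau> ^ (2 * l - 1) / 2 * card {C \<in> H. T \<subseteq> C}" for T
  proof -
    have "wdeg E w T = (\<Sum>C\<in>{C \<in> H. T \<subseteq> C}. w C)"
      unfolding wdeg_def using finE HE by (intro sum.mono_neutral_right) (auto simp: w_def)
    also have "\<dots> = (\<Sum>C\<in>{C \<in> H. T \<subseteq> C}. \<tau> ^ (2 * l - 1) / 2)" by (intro sum.cong) (auto simp: w_def)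
    finally show ?thesis by simp
  qed
  show "wdeg E w T \<le> \<tau> ^ (card T - 1)" if "T \<noteq> {}" for T
  proof (cases "{C \<in> H. T \<subseteq> C} = {}")
    case True
    then show ?thesis using \<tau> unfolding wdeg True by simp
  next
    case False
    then obtain C where C: "C \<in> H" "T \<subseteq> C" by blast
    then have "finite C" using HE finE finite_subset by blast
    then have "card T \<le> 2 * l" "0 < card T"
      using C HE(2)[OF C(1)] card_mono[of C T] that finite_subset[of T C] by (auto simp: card_gt_0_iff)
    then have "\<tau> ^ (2 * l - 1) = \<tau> ^ (card T - 1) * \<tau> ^ (2 * l - card T)" by (simp flip: power_add)
    then have eq: "\<tau> ^ (2 * l - 1) * (1 / \<tau>) ^ (2 * l - card T) = \<tau> ^ (card T - 1)"
      using \<tau> by (simp add: power_divide)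
    have "wdeg E w T \<le> \<tau> ^ (2 * l - 1) / 2 * (2 * (1 / \<tau>) ^ (2 * l - card T))"
      unfolding wdeg using deg[OF that] \<tau> by (intro mult_left_mono) auto
    then show ?thesis using eq by simp
  qed
  have "\<tau> ^ (2 * l - 1) / 2 * (card E * (1 / \<tau>) ^ (2 * l - 1) / 2 ^ (2 * l + 2)) \<le> wdeg E w {}"
    unfolding wdeg using large \<tau> by (intro mult_left_mono) auto
  moreover have "\<tau> ^ (2 * l - 1) / 2 * (card E * (1 / \<tau>) ^ (2 * l - 1) / 2 ^ (2 * l + 2)) = 1 / 2 ^ (2 * l + 3) * card E"
    using \<tau> by (simp add: power_divide power_add)
  ultimately show "1 / 2 ^ (2 * l + 3) * card E \<le> wdeg E w {}" by simp
  show "independent_set w I" if "I \<subseteq> E" "cycles_in (2 * l) I = {}" for I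
    unfolding independent_set_def
  proof (intro allI impI)
    fix e assume "e \<subseteq> I"
    then have "e \<notin> cycles_in (2 * l) E" using that(2) cycles_in_restrict[of e "2 * l" E I] by auto
    then show "w e = 0" using H by (auto simp: w_def)
  qed
qed

text \<open>\<open>p\<close> is chosen to make the density condition of the supersaturation lemma an equality, and \<open>\<tau>\<close> to make
  \<open>p ^ (2 * l - 2) = \<tau> ^ (2 * l - 1)\<close>.\<close>

lemma sampling_parameters:
  fixes l :: nat and K B n m :: real
  assumes l: "2 \<le> l" and n: "1 \<le> n" and B: "1 \<le> B" "B \<le> K" and m: "m = K * n powr (1 + 1 / l)" "m \<le> n\<^sup>2"
    and p_def: "p = (K / B) powr - (real l / (real l - 1))" and \<tau>_def: "\<tau> = (K / B) powr - (2 * real l / (2 * real l - 1))"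
  shows "0 < p" "p \<le> \<tau>" "\<tau> \<le> B / K" "\<tau> \<le> 1" "p ^ (2 * l - 2) \<le> \<tau> ^ (2 * l - 1)" "1 \<le> p * n"
    "B * (p * n) powr (1 + 1 / l) \<le> p\<^sup>2 * m" "\<tau> * m = B * (K / B) powr - (1 / (2 * real l - 1)) * n powr (1 + 1 / l)"
    "1 \<le> \<tau> * m" "ln (1 / \<tau>) \<le> 2 * ln (K / B)"
proof -
  define x where "x = K / B"
  have x: "1 \<le> x" "K = B * x" using B by (auto simp: x_def)
  have l': "real (l - 1) = real l - 1" "real (2 * l - 1) = 2 * real l - 1" "real (2 * l - 2) = 2 * (real l - 1)"
    using l by (auto simp: of_nat_diff)
  define s where "s = real l / (real l - 1)"
  define t where "t = 2 * real l / (2 * real l - 1)"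
  have p: "p = x powr - s" and \<tau>: "\<tau> = x powr - t" using l by (simp_all add: p_def \<tau>_def x_def s_def t_def l' of_nat_diff)
  have st: "t \<le> s" "1 \<le> t" "t \<le> 2" using l by (auto simp: s_def t_def field_simps)
  show "0 < p" using x by (simp add: p)
  show "p \<le> \<tau>" unfolding p \<tau> using x st by (intro powr_mono) auto
  have "\<tau> \<le> x powr - 1" unfolding \<tau> using x st by (intro powr_mono) auto
  also have "\<dots> = B / K" using x(1) powr_neg_one[of x] by (simp add: x_def)
  finally show \<tau>B: "\<tau> \<le> B / K" .
  have "B / K \<le> 1" using B by simp
  then show "\<tau> \<le> 1" using \<tau>B by linarith
  have "p ^ (2 * l - 2) = x powr (- s * real (2 * l - 2))"
    using x(1) unfolding p by (subst powr_power) (auto simp: mult.commute)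
  also have "- s * real (2 * l - 2) = - real (2 * l)" using l unfolding l' s_def by (simp add: field_simps)
  also have "- real (2 * l) = - t * real (2 * l - 1)" using l unfolding l' t_def by (simp add: field_simps)
  also have "x powr (- t * real (2 * l - 1)) = \<tau> ^ (2 * l - 1)"
    using x(1) unfolding \<tau> by (subst powr_power) (auto simp: mult.commute)
  finally show "p ^ (2 * l - 2) \<le> \<tau> ^ (2 * l - 1)" by simp
  \<comment> \<open>A graph has at most \<open>n\<^sup>2\<close> edges, so
    \<open>K \<le> n powr (1 / s)\<close>; this keeps the expected sample size \<open>p * n\<close>
    at least 1.\<close>
  have "K * n powr (1 + 1 / l) \<le> n powr 2" using m n by (simp add: powr_numeral)
  also have "2 = 1 / s + (1 + 1 / l)" using l by (simp add: s_def field_simps)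
  also have "n powr (1 / s + (1 + 1 / l)) = n powr (1 / s) * n powr (1 + 1 / l)" by (rule powr_add)
  finally have "K \<le> n powr (1 / s)" using n by simp
  moreover have "x \<le> K" using B by (simp add: x_def field_simps mult_le_cancel_left1)
  ultimately have xn: "x \<le> n powr (1 / s)" by linarith
  have "(n powr (1 / s)) powr - s \<le> x powr - s" using x xn st by (intro powr_mono2') auto
  moreover have "(n powr (1 / s)) powr - s = 1 / n" using n st by (simp add: powr_powr powr_minus_divide)
  ultimately have "1 / n \<le> p" by (simp add: p)
  then show "1 \<le> p * n" using n by (simp add: field_simps)
  have "p powr (1 + 1 / l) * B = p powr (1 + 1 / l) * (p powr (1 / s) * K)"
  proof -
    have "p powr (1 / s) = x powr - 1" using st by (simp add: p powr_powr)
    then have "p powr (1 / s) * K = B" using x powr_neg_one[of x] by simp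
    then show ?thesis by simp
  qed
  also have "\<dots> = p\<^sup>2 * K"
  proof -
    have "1 + 1 / l + 1 / s = 2" using l by (simp add: s_def field_simps)
    then have "p powr (1 + 1 / l) * p powr (1 / s) = p powr 2" by (simp only: powr_add[symmetric])
    then have "p powr (1 + 1 / l) * p powr (1 / s) = p\<^sup>2" using \<open>0 < p\<close> by (simp add: powr_numeral)
    then show ?thesis by (metis mult.assoc)
  qed
  finally show "B * (p * n) powr (1 + 1 / l) \<le> p\<^sup>2 * m"
    using \<open>0 < p\<close> n by (simp add: powr_mult m mult_ac)
  \<comment> \<open>The gain of the method: \<open>t\<close> exceeds 1, so multiplying \<tau> by
    \<open>K\<close> still leaves a negative power of \<open>K / B\<close>.\<close>
  have "x powr - t * x powr 1 = x powr (- t + 1)" by (rule powr_add[symmetric])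
  also have "- t + 1 = - (1 / (2 * real l - 1))" using l by (simp add: t_def field_simps)
  finally have "x powr - t * x = x powr - (1 / (2 * real l - 1))" using x by simp
  then show eq: "\<tau> * m = B * (K / B) powr - (1 / (2 * real l - 1)) * n powr (1 + 1 / l)"
    by (simp add: \<tau> m x(2) x_def[symmetric] mult_ac)
  have "x powr (1 / (2 * real l - 1)) \<le> x powr 1" using x l by (intro powr_mono) auto
  also have "\<dots> \<le> n powr (1 / s)" using x xn by simp
  also have "\<dots> \<le> n powr (1 + 1 / l)" using n l by (intro powr_mono) (auto simp: s_def field_simps)
  finally have "x powr (1 / (2 * real l - 1)) \<le> n powr (1 + 1 / l)" .
  then have "1 \<le> x powr - (1 / (2 * real l - 1)) * n powr (1 + 1 / l)" using x by (simp add: powr_minus_divide field_simps)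
  then have "1 * 1 \<le> B * (x powr - (1 / (2 * real l - 1)) * n powr (1 + 1 / l))" using B by (intro mult_mono) auto
  then show "1 \<le> \<tau> * m" unfolding eq by (simp add: x_def mult.assoc)
  have "ln (1 / \<tau>) = t * ln x" using x by (simp add: \<tau> ln_div ln_powr)
  also have "\<dots> \<le> 2 * ln x" using x st by (intro mult_right_mono) auto
  finally show "ln (1 / \<tau>) \<le> 2 * ln (K / B)" by (simp add: x_def)
qed

lemma ln_le_powr_div:
  fixes x \<eta> :: real
  assumes "0 < x" "0 < \<eta>"
  shows "ln x \<le> x powr \<eta> / \<eta>"
proof -
  have "\<eta> * ln x = ln (x powr \<eta>)" using assms by (simp add: ln_powr)
  also have "\<dots> \<le> x powr \<eta>" using assms ln_le_minus_one[of "x powr \<eta>"] by simp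
  finally show ?thesis using assms by (simp add: field_simps)
qed

lemma even_cycle_container_step:
  assumes l: "2 \<le> l"
  shows "\<exists>(c :: real) (K0 :: real) (a :: real) (\<eta> :: real). 0 < c \<and> c < 1 \<and> 0 < K0 \<and> 0 \<le> a \<and> 0 < \<eta> \<and>
    (\<forall>(V :: 'a set) E. finite V \<longrightarrow> V \<noteq> {} \<longrightarrow> E \<subseteq> edges_on V \<longrightarrow>
      K0 * card V powr (1 + 1 / l) \<le> card E \<longrightarrow>
      (\<exists>\<C>. finite \<C> \<and>
        real (card \<C>) \<le> exp (a * (card E / card V powr (1 + 1 / l)) powr - \<eta> * card V powr (1 + 1 / l)) \<and>
        (\<forall>C\<in>\<C>. C \<subseteq> E \<and> card C \<le> (1 - c) * card E) \<and>
        (\<forall>I\<subseteq>E. cycles_in (2 * l) I = {} \<longrightarrow> (\<exists>C\<in>\<C>. I \<subseteq> C))))"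
proof -
  obtain c \<tau>0 :: real where c: "0 < c" "c < 1" and \<tau>0: "0 < \<tau>0" "\<tau>0 \<le> 1"
    and containers: "\<forall>(V :: 'a set set) w (\<tau> :: real). finite V \<longrightarrow> 0 < \<tau> \<longrightarrow> \<tau> \<le> \<tau>0 \<longrightarrow>
    1 \<le> \<tau> * card V \<longrightarrow> weight_on V (2 * l) w \<longrightarrow> (\<forall>T. T \<noteq> {} \<longrightarrow> wdeg V w T \<le> \<tau> ^ (card T - 1)) \<longrightarrow>
    1 / 2 ^ (2 * l + 3) * card V \<le> wdeg V w {} \<longrightarrow>
    (\<exists>\<C>. finite \<C> \<and> real (card \<C>) \<le> (1 / \<tau>) powr (3 * (2 * l) * \<tau> * card V) \<and>
       (\<forall>C\<in>\<C>. C \<subseteq> V \<and> card C \<le> (1 - c) * card V) \<and>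
       (\<forall>I\<subseteq>V. independent_set w I \<longrightarrow> (\<exists>C\<in>\<C>. I \<subseteq> C)))"
    using hypergraph_containers[of "1 / 2 ^ (2 * l + 3)" "2 * l", OF divide_pos_pos[OF zero_less_one zero_less_power[OF zero_less_numeral]]]
    by (elim exE conjE) (rule that)
  \<comment> \<open>The 12 of the supersaturation lemma times the \<open>24 * l\<close> of the
    extremal bound.\<close>
  define B where "B = 288 * real l"
  \<comment> \<open>Ensures \<open>\<tau> \<le> B / K \<le> \<tau>0\<close> for every
    \<open>K \<ge> K0\<close>.\<close>
  define K0 where "K0 = B / \<tau>0"
  define \<eta> where "\<eta> = 1 / (2 * (2 * real l - 1))"
  \<comment> \<open>Collects \<open>3 * (2 * l)\<close> from the containers, 2 from
    \<open>ln (1 / \<tau>) \<le> 2 * ln (K / B)\<close>, \<open>B\<close> from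
    \<open>\<tau> * m\<close>, and \<open>B powr \<eta> / \<eta>\<close> from bounding the
    logarithm.\<close>
  define a where "a = 12 * real l * B / \<eta> * B powr \<eta>"
  have B: "1 \<le> B" using l by (simp add: B_def)
  have K0: "0 < K0" "B \<le> K0" using B \<tau>0 by (auto simp: K0_def field_simps)
  have \<eta>: "0 < \<eta>" using l by (simp add: \<eta>_def)
  have a: "0 \<le> a" using B \<eta> by (simp add: a_def)
  have main: "\<exists>\<C>. finite \<C> \<and>
        real (card \<C>) \<le> exp (a * (card E / card V powr (1 + 1 / l)) powr - \<eta> * card V powr (1 + 1 / l)) \<and>
        (\<forall>C\<in>\<C>. C \<subseteq> E \<and> card C \<le> (1 - c) * card E) \<and>
        (\<forall>I\<subseteq>E. cycles_in (2 * l) I = {} \<longrightarrow> (\<exists>C\<in>\<C>. I \<subseteq> C))"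
    if fin: "finite V" and "V \<noteq> {}" and E: "E \<subseteq> edges_on V" and dense: "K0 * card V powr (1 + 1 / l) \<le> card E"
    for V :: "'a set" and E
  proof -
    define n where "n = real (card V)"
    define m where "m = real (card E)"
    define f where "f = n powr (1 + 1 / l)"
    define K where "K = m / f"
    define p where "p = (K / B) powr - (real l / (real l - 1))"
    define \<tau> where "\<tau> = (K / B) powr - (2 * real l / (2 * real l - 1))"
    have n: "1 \<le> n" using \<open>V \<noteq> {}\<close> fin by (simp add: n_def Suc_leI card_gt_0_iff)
    have f: "0 < f" using n by (simp add: f_def)
    have K: "K0 \<le> K" using dense f by (simp add: K_def m_def f_def n_def pos_le_divide_eq)
    have mK: "m = K * n powr (1 + 1 / l)" using f by (simp add: K_def f_def)
    have mn: "m \<le> n\<^sup>2" using card_edges_on_le[OF fin E] by (simp add: m_def n_def)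
    have finE: "finite E" using finite_subset_edges_on[OF fin E] .
    have BK: "B \<le> K" using K K0 by linarith
    note par = sampling_parameters[OF l n B BK mK mn p_def \<tau>_def]
    have \<tau>pos: "0 < \<tau>" using par(1,2) by linarith
    have "0 < K" using BK B by linarith
    then have "B / K \<le> \<tau>0" using K \<tau>0 by (simp add: K0_def field_simps)
    then have \<tau>le: "\<tau> \<le> \<tau>0" using par(3) by linarith
    have ex: "card E' \<le> 24 * real l * card U powr (1 + 1 / l)"
      if "U \<subseteq> V" "E' \<subseteq> edges_on U" "cycles_in (2 * l) E' = {}" for U E'
      using bondy_simonovits[OF l _ that(2,3)] that(1) fin finite_subset by blast
    obtain H where H: "H \<subseteq> cycles_in (2 * l) E"
      "\<And>T. T \<noteq> {} \<Longrightarrow> card {C \<in> H. T \<subseteq> C} \<le> 2 * (1 / \<tau>) ^ (2 * l - card T)"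
      "card E * (1 / \<tau>) ^ (2 * l - 1) / 2 ^ (2 * l + 2) \<le> card H"
    proof (rule balanced_supersaturation[OF l fin E ex, where p = p and \<tau> = \<tau>])
      show "12 * (24 * real l) * (p * card V) powr (1 + 1 / l) \<le> p\<^sup>2 * card E"
        using par(7) by (simp add: B_def n_def m_def)
      show "1 \<le> p * card V" using par(6) by (simp add: n_def)
      show "1 + 1 / real l \<le> 2" using l by simp
    qed (use par in auto)
    define w where "w = (\<lambda>C. if C \<in> H then \<tau> ^ (2 * l - 1) / 2 else 0)"
    have bw: "weight_on E (2 * l) w" "\<forall>T. T \<noteq> {} \<longrightarrow> wdeg E w T \<le> \<tau> ^ (card T - 1)"
      "1 / 2 ^ (2 * l + 3) * card E \<le> wdeg E w {}" "\<And>I. I \<subseteq> E \<Longrightarrow> cycles_in (2 * l) I = {} \<Longrightarrow> independent_set w I"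
      using balanced_weight[OF l \<tau>pos finE H w_def] by blast+
    have tm: "1 \<le> \<tau> * card E" using par(9) by (simp add: m_def)
    obtain \<C> where C: "finite \<C>" "real (card \<C>) \<le> (1 / \<tau>) powr (3 * (2 * l) * \<tau> * card E)"
       "\<forall>C\<in>\<C>. C \<subseteq> E \<and> card C \<le> (1 - c) * card E"
       "\<forall>I\<subseteq>E. independent_set w I \<longrightarrow> (\<exists>C\<in>\<C>. I \<subseteq> C)"
      using containers[THEN spec, THEN spec, THEN spec, THEN mp, OF finE, THEN mp, OF \<tau>pos, THEN mp, OF \<tau>le,
          THEN mp, OF tm, THEN mp, OF bw(1), THEN mp, OF bw(2), THEN mp, OF bw(3)]
      by (elim exE conjE) (rule that)
    have x: "0 < K / B" using BK B by simp
    have "(1 / \<tau>) powr (3 * (2 * l) * \<tau> * card E) = exp (6 * l * (\<tau> * m) * ln (1 / \<tau>))"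
      using \<tau>pos by (simp add: powr_def m_def mult_ac)
    also have "\<dots> \<le> exp (a * K powr - \<eta> * f)"
    proof -
      have "6 * l * (\<tau> * m) * ln (1 / \<tau>) \<le> 6 * l * (\<tau> * m) * (2 * ((K / B) powr \<eta> / \<eta>))"
        using par(9,10) ln_le_powr_div[OF x \<eta>] by (intro mult_left_mono) auto
      also have "\<dots> = 12 * l * B / \<eta> * ((K / B) powr - (1 / (2 * real l - 1)) * (K / B) powr \<eta>) * f"
        unfolding par(8) by (simp add: f_def)
      also have "(K / B) powr - (1 / (2 * real l - 1)) * (K / B) powr \<eta> = (K / B) powr - \<eta>"
      proof -
        have "- (1 / (2 * real l - 1)) + \<eta> = - \<eta>" using l by (simp add: \<eta>_def add_divide_distrib[symmetric] divide_simps)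
        then show ?thesis by (simp only: powr_add[symmetric])
      qed
      also have "(K / B) powr - \<eta> = K powr - \<eta> * B powr \<eta>"
        using B BK by (simp add: powr_divide powr_minus_divide)
      finally show ?thesis by (simp add: a_def mult_ac)
    qed
    finally have "real (card \<C>) \<le> exp (a * K powr - \<eta> * f)" using C(2) by linarith
    moreover have "\<exists>C\<in>\<C>. I \<subseteq> C" if "I \<subseteq> E" "cycles_in (2 * l) I = {}" for I
      using C(4) bw(4)[OF that] that(1) by blast
    ultimately show ?thesis using C(1,3) unfolding K_def m_def f_def n_def
      by (intro exI[of _ \<C>] conjI allI impI) 
  qed
  show ?thesis
    by (rule exI[of _ c], rule exI[of _ K0], rule exI[of _ a], rule exI[of _ \<eta>], intro conjI allI impI)
      (rule c K0 a \<eta> | rule main, assumption+)+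
qed

section \<open>From edge sets back to labelled graphs\<close>

lemma free_of_cycle_graph:
  assumes G: "simple_graph G" and free: "free_of (cycle_graph k) G"
  shows "cycles_in k (uedges G) = {}"
proof (rule ccontr)
  assume "\<not> ?thesis"
  then obtain f where f: "inj_on f {..<k}"
    and sub: "(\<lambda>i. {f i, f (Suc i mod k)}) ` {..<k} \<subseteq> uedges G"
    by (auto simp: cycles_in_def)
  define C where "C = (\<lambda>i. {f i, f (Suc i mod k)}) ` {..<k}"
  define J where "J = (f ` {..<k}, C)"
  have e: "e \<subseteq> uverts G" "card e = 2" if "e \<in> C" for e
    using that G sub unfolding simple_graph_def C_def by blast+
  have "e \<subseteq> f ` {..<k}" if "e \<in> C" for e using that by (auto simp: C_def)
  then have "simple_graph J" using e by (auto simp: simple_graph_def J_def)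
  moreover have "subgraph_of J G"
  proof -
    have "f i \<in> uverts G" if "i < k" for i using e(1)[of "{f i, f (Suc i mod k)}"] that by (auto simp: C_def)
    then show ?thesis using sub by (auto simp: subgraph_of_def J_def C_def)
  qed
  moreover have "graph_iso (cycle_graph k) J"
  proof -
    have "C = (\<lambda>e. f ` e) ` {{i, (i + 1) mod k} | i. i < k}"
      by (simp add: C_def setcompr_eq_image image_image lessThan_def)
    moreover have "bij_betw f {0..<k} (f ` {..<k})" using f by (simp add: bij_betw_def atLeast0LessThan)
    ultimately show ?thesis unfolding graph_iso_def by (auto simp: cycle_graph_def J_def)
  qed
  ultimately show False using free unfolding free_of_def by blast
qed

theorem theorem1p2:
  fixes l :: nat and \<delta> :: real
  assumes "l \<ge> 2" and "\<delta> > 0"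
  shows "\<exists>C::real. \<forall>\<^sub>F n::nat in sequentially.
    \<exists>\<G> \<subseteq> graphs_on {1..n}.
      finite \<G> \<and>
      real (card \<G>) \<le> 2 powr (\<delta> * real n powr (1 + 1 / real l)) \<and>
      (\<forall>G \<in> \<G>. real (card (uedges G)) \<le> C * real n powr (1 + 1 / real l)) \<and>
      (\<forall>H \<in> graphs_on {1..n}. free_of (cycle_graph (2 * l)) H \<longrightarrow>
         (\<exists>G \<in> \<G>. subgraph_of H G))"
proof -
  obtain c K0 a \<eta> :: real where c: "0 < c" "c < 1" and K0: "0 < K0" and a: "0 \<le> a" and \<eta>: "0 < \<eta>"
    and step: "\<forall>(V :: nat set) E. finite V \<longrightarrow> V \<noteq> {} \<longrightarrow> E \<subseteq> edges_on V \<longrightarrow>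
      K0 * card V powr (1 + 1 / l) \<le> card E \<longrightarrow>
      (\<exists>\<C>. finite \<C> \<and>
        real (card \<C>) \<le> exp (a * (card E / card V powr (1 + 1 / l)) powr - \<eta> * card V powr (1 + 1 / l)) \<and>
        (\<forall>C\<in>\<C>. C \<subseteq> E \<and> card C \<le> (1 - c) * card E) \<and>
        (\<forall>I\<subseteq>E. cycles_in (2 * l) I = {} \<longrightarrow> (\<exists>C\<in>\<C>. I \<subseteq> C)))"
    using even_cycle_container_step[OF assms(1)] by (elim exE conjE) (rule that)
  have gap: "0 < (1 - c) powr - \<eta> - 1"
  proof -
    have "ln (1 - c) < 0" using c by simp
    then have "0 < - \<eta> * ln (1 - c)" using \<eta> by (simp add: mult_less_0_iff)
    then show ?thesis using c by (simp add: powr_def)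
  qed
  \<comment> \<open>Fixed by the telescoping condition; \<open>a + 1\<close> in place of
    \<open>a\<close> keeps \<open>D\<close> positive when \<open>a = 0\<close>.\<close>
  define D where "D = (a + 1) / ((1 - c) powr - \<eta> - 1)"
  have D: "0 < D" "D * ((1 - c) powr - \<eta> - 1) = a + 1" using a gap by (auto simp: D_def)
  \<comment> \<open>Solves \<open>D * ((1 - c) * K) powr - \<eta> \<le> \<delta> * ln 2\<close>,
    where \<open>ln 2\<close> accounts for counting in powers of 2.\<close>
  define K where "K = max K0 ((D / (\<delta> * ln 2)) powr (1 / \<eta>) / (1 - c))"
  have K: "0 < K" "K0 \<le> K" using K0 by (auto simp: K_def)
  have small: "D * ((1 - c) * K) powr - \<eta> \<le> \<delta> * ln 2"
  proof -
    have pos: "0 < D / (\<delta> * ln 2)" using D assms(2) by simp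
    have "(D / (\<delta> * ln 2)) powr (1 / \<eta>) / (1 - c) \<le> K" by (simp add: K_def)
    then have "(D / (\<delta> * ln 2)) powr (1 / \<eta>) \<le> (1 - c) * K" using c by (simp add: field_simps)
    then have "((1 - c) * K) powr - \<eta> \<le> ((D / (\<delta> * ln 2)) powr (1 / \<eta>)) powr - \<eta>"
      using pos \<eta> by (intro powr_mono2') auto
    also have "\<dots> = (D / (\<delta> * ln 2)) powr - 1" using \<eta> by (simp add: powr_powr)
    also have "\<dots> = \<delta> * ln 2 / D" using powr_neg_one[OF pos] by simp
    finally show ?thesis using D(1) by (simp add: field_simps)
  qed
  have "\<exists>\<G> \<subseteq> graphs_on {1..n}.
      finite \<G> \<and>
      real (card \<G>) \<le> 2 powr (\<delta> * real n powr (1 + 1 / real l)) \<and>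
      (\<forall>G \<in> \<G>. real (card (uedges G)) \<le> K * real n powr (1 + 1 / real l)) \<and>
      (\<forall>H \<in> graphs_on {1..n}. free_of (cycle_graph (2 * l)) H \<longrightarrow>
         (\<exists>G \<in> \<G>. subgraph_of H G))" if "1 \<le> n" for n
  proof -
    define V where "V = {1..n}"
    define f where "f = real n powr (1 + 1 / real l)"
    have V: "finite V" "V \<noteq> {}" "card V = n" using that by (auto simp: V_def)
    have f: "0 < f" using that by (simp add: f_def)
    \<comment> \<open>The maximum meets the lower bound on \<open>M\<close> in the iteration also
      when the complete graph is already sparse enough.\<close>
    define M where "M = max (real (card (edges_on V))) ((1 - c) * K * f)"
    have "\<exists>\<F>. finite \<F> \<and> real (card \<F>) \<le> exp (D * f * (((1 - c) * K) powr - \<eta> - (M / f) powr - \<eta>)) \<and>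
      (\<forall>F\<in>\<F>. F \<subseteq> edges_on V \<and> card F \<le> K * f) \<and> (\<forall>I\<subseteq>edges_on V. cycles_in (2 * l) I = {} \<longrightarrow> (\<exists>F\<in>\<F>. I \<subseteq> F))"
    proof (rule container_iteration[where a = "a + 1", OF f c \<eta> less_imp_le[OF D(1)] D(2) K(1)])
      fix E assume E: "E \<subseteq> edges_on V" "K * f \<le> card E"
      have "K0 * f \<le> card E" using K(2) E(2) f mult_right_mono[of K0 K f] by linarith
      then obtain \<C> where C: "finite \<C>" "real (card \<C>) \<le> exp (a * (card E / f) powr - \<eta> * f)"
        "\<forall>C\<in>\<C>. C \<subseteq> E \<and> card C \<le> (1 - c) * card E"
        "\<forall>I\<subseteq>E. cycles_in (2 * l) I = {} \<longrightarrow> (\<exists>C\<in>\<C>. I \<subseteq> C)"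
        using step[rule_format, OF V(1,2) E(1)] unfolding V(3) f_def[symmetric] by meson
      have "exp (a * (card E / f) powr - \<eta> * f) \<le> exp ((a + 1) * (card E / f) powr - \<eta> * f)"
        using f by (simp add: mult_right_mono)
      then have "real (card \<C>) \<le> exp ((a + 1) * (card E / f) powr - \<eta> * f)" using C(2) by linarith
      then show "\<exists>\<C>. finite \<C> \<and> real (card \<C>) \<le> exp ((a + 1) * (card E / f) powr - \<eta> * f) \<and>
        (\<forall>C\<in>\<C>. C \<subseteq> E \<and> card C \<le> (1 - c) * card E) \<and>
        (\<forall>I\<subseteq>E. cycles_in (2 * l) I = {} \<longrightarrow> (\<exists>C\<in>\<C>. I \<subseteq> C))"
        using C(1,3,4) by (intro exI[of _ \<C>] conjI)
    qed (auto simp: M_def)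
    then obtain \<F> where F: "finite \<F>" "real (card \<F>) \<le> exp (D * f * (((1 - c) * K) powr - \<eta> - (M / f) powr - \<eta>))"
      "\<forall>F\<in>\<F>. F \<subseteq> edges_on V \<and> card F \<le> K * f"
      "\<forall>I\<subseteq>edges_on V. cycles_in (2 * l) I = {} \<longrightarrow> (\<exists>F\<in>\<F>. I \<subseteq> F)"
      by (elim exE conjE) (rule that)
    define \<G> where "\<G> = Pair V ` \<F>"
    have "D * f * (((1 - c) * K) powr - \<eta> - (M / f) powr - \<eta>) \<le> D * f * ((1 - c) * K) powr - \<eta>"
      using D(1) f by (intro mult_left_mono) auto
    also have "\<dots> = f * (D * ((1 - c) * K) powr - \<eta>)" by simp
    also have "\<dots> \<le> f * (\<delta> * ln 2)" using small f by (intro mult_left_mono) auto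
    finally have "real (card \<F>) \<le> exp (f * (\<delta> * ln 2))" using F(2) by (meson exp_le_cancel_iff order_trans)
    also have "\<dots> = 2 powr (\<delta> * f)" by (simp add: powr_def mult_ac)
    finally have "real (card \<G>) \<le> 2 powr (\<delta> * f)"
      by (simp add: \<G>_def card_image inj_on_def)
    moreover have "\<G> \<subseteq> graphs_on {1..n}"
      using F(3) by (fastforce simp: \<G>_def graphs_on_def simple_graph_def V_def edges_on_def)
    moreover have "\<exists>G\<in>\<G>. subgraph_of H G" if H: "H \<in> graphs_on {1..n}" "free_of (cycle_graph (2 * l)) H" for H
    proof -
      have "simple_graph H" "uverts H = V" using H(1) by (auto simp: graphs_on_def V_def)
      then have "uedges H \<subseteq> edges_on V" "cycles_in (2 * l) (uedges H) = {}"
        using free_of_cycle_graph[OF _ H(2)] by (auto simp: simple_graph_def edges_on_def)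
      then obtain F where "F \<in> \<F>" "uedges H \<subseteq> F" using F(4) by blast
      then show ?thesis using \<open>uverts H = V\<close> by (auto simp: \<G>_def subgraph_of_def)
    qed
    moreover have "finite \<G>" using F(1) by (simp add: \<G>_def)
    moreover have "\<forall>G\<in>\<G>. card (uedges G) \<le> K * f" using F(3) by (auto simp: \<G>_def)
    ultimately show ?thesis unfolding f_def by (intro exI[of _ \<G>] conjI ballI impI) auto
  qed
  then show ?thesis by (intro exI[of _ K]) (auto intro: eventually_sequentiallyI[of 1])
qed

end
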